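(* Let $1\le k<d$ be integers and let $X\subseteq\mathbb{R}^d$ be a Borel set. If $u\in[0,k]$ and $u\le\sup_{\theta\in[0,1]}\big(\dim_{\mathrm F}^{\theta}X-(d-k)\theta\big)$, then $$\{V\in G(d,k):\dim_{\mathrm H}P_V(X)<u\}=\varnothing.$$
   Context: $G(d,k)$ is the Grassmannian of $k$-dimensional linear subspaces $V$ of $\mathbb{R}^d$, and $P_V:\mathbb{R}^d\to V$ is orthogonal projection. $\dim_{\mathrm H}$ is Hausdorff dimension. For $X\subseteq\mathbb{R}^d$, $\mathcal M(X)$ is the set of Borel measures $\mu$ compactly supported on $X$ with $0<\mu(X)<\infty$. The Fourier transform is $\widehat\mu(z)=\int e^{-2\pi i z\cdot x}\,d\mu(x)$. For $\mu\in\mathcal M(\mathbb{R}^d)$ and $\theta\in(0,1]$ put $$\mathcal J_{s,\theta}(\mu)=\Big(\int_{\mathbb{R}^d}|\widehat\mu(z)|^{2/\theta}|z|^{s/\theta-d}\,dz\Big)^{\theta},\qquad \mathcal J_{s,0}(\mu)=\sup_{z\in\mathbb{R}^d}|\widehat\mu(z)|^2|z|^s.$$ The Fourier spectrum of $\mu$ at $\theta\in[0,1]$ is $\dim_{\mathrm F}^{\theta}\mu=\sup\{s\in\mathbb{R}:\mathcal J_{s,\theta}(\mu)<\infty\}$, and of a Borel set $X\subseteq\mathbb{R}^d$ it is $\dim_{\mathrm F}^{\theta}X=\sup\{\min\{\dim_{\mathrm F}^{\theta}\mu,d\}:\mu\in\mathcal M(X)\}$ (suprema over empty sets are $0$). 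*)

theory Defs
  imports "HOL-Analysis.Analysis"
begin

section \<open>Hausdorff dimension\<close>

text \<open>
  The \<open>s\<close>-th power of the diameter of \<open>U\<close>, with the usual conventions for the counting case
  \<open>s = 0\<close> (in HOL, \<open>0 powr 0 = 0\<close>). It is only meaningful for bounded \<open>U\<close>.
\<close>

definition diam_powr :: "real \<Rightarrow> 'a::metric_space set \<Rightarrow> ennreal" where
  "diam_powr s U =
     (if U = {} then 0 else if s = 0 then 1 else ennreal (diameter U powr s))"

text \<open>
  \<^const>\<open>diameter\<close> is unspecified on unbounded sets, hence the explicit boundedness condition.
  Finite covers are included, as the \<open>U i\<close> may be empty.
\<close>

definition hausdorff_pre_measure :: "real \<Rightarrow> real \<Rightarrow> 'a::metric_space set \<Rightarrow> ennreal" where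
  "hausdorff_pre_measure s \<delta> A =
     Inf {\<Sum>i. diam_powr s (U i) | U :: nat \<Rightarrow> 'a set.
            A \<subseteq> (\<Union>i. U i) \<and> (\<forall>i. bounded (U i) \<and> diameter (U i) \<le> \<delta>)}"

definition hausdorff_measure :: "real \<Rightarrow> 'a::metric_space set \<Rightarrow> ennreal" where
  "hausdorff_measure s A = (SUP \<delta>\<in>{0<..}. hausdorff_pre_measure s \<delta> A)"

definition hausdorff_dim :: "'a::metric_space set \<Rightarrow> ereal" where
  "hausdorff_dim A = Inf {ereal s | s. 0 \<le> s \<and> hausdorff_measure s A = 0}"


section \<open>Grassmannian and orthogonal projection\<close>

definition grassmannian :: "nat \<Rightarrow> 'a::euclidean_space set set" where
  "grassmannian k = {V. subspace V \<and> dim V = k}"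

definition orth_proj :: "'a::euclidean_space set \<Rightarrow> 'a \<Rightarrow> 'a" where
  "orth_proj V x = (THE y. y \<in> V \<and> (\<forall>v\<in>V. orthogonal (x - y) v))"


section \<open>Measures and the Fourier spectrum\<close>

definition measure_support :: "'a::topological_space measure \<Rightarrow> 'a set" where
  "measure_support \<mu> = - \<Union>{U. open U \<and> emeasure \<mu> U = 0}"

definition supported_measures :: "'a::euclidean_space set \<Rightarrow> 'a measure set" where
  "supported_measures X =
     {\<mu>. sets \<mu> = sets borel \<and> compact (measure_support \<mu>) \<and> measure_support \<mu> \<subseteq> X
          \<and> 0 < emeasure \<mu> X \<and> emeasure \<mu> X < \<infinity>}"

definition fourier_transform :: "'a::euclidean_space measure \<Rightarrow> 'a \<Rightarrow> complex" where
  "fourier_transform \<mu> z =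
     (LINT x|\<mu>. exp (- 2 * of_real pi * \<i> * of_real (z \<bullet> x)))"

text \<open>Powers of extended non-negative reals, intended for exponents \<open>\<theta> > 0\<close>.\<close>

definition ennreal_powr :: "ennreal \<Rightarrow> real \<Rightarrow> ennreal" where
  "ennreal_powr x \<theta> = (if x = \<infinity> then \<infinity> else ennreal (enn2real x powr \<theta>))"

text \<open>
  In HOL, \<open>0 powr t = 0\<close> for every \<open>t\<close>, which concerns only the point \<open>z = 0\<close> when the exponent
  of \<open>norm z\<close> is not positive. For \<open>\<theta> > 0\<close> that point is a null set. For \<open>\<theta> = 0\<close> and a finite
  non-zero measure the supremum is unaffected, by considering \<open>z \<rightarrow> 0\<close>: it is infinite
  for \<open>s < 0\<close>, and for \<open>s = 0\<close> it still is the squared total mass.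
\<close>

definition fourier_energy :: "real \<Rightarrow> real \<Rightarrow> 'a::euclidean_space measure \<Rightarrow> ennreal" where
  "fourier_energy s \<theta> \<mu> =
     (if \<theta> = 0 then
        (SUP z. ennreal (norm (fourier_transform \<mu> z) ^ 2 * norm z powr s))
      else
        ennreal_powr
          (\<integral>\<^sup>+ z. ennreal (norm (fourier_transform \<mu> z) powr (2 / \<theta>)
                          * norm z powr (s / \<theta> - real DIM('a))) \<partial>lborel) \<theta>)"

text \<open>Supremum with the convention that the supremum of the empty set is \<open>0\<close>.\<close>

definition Sup0 :: "ereal set \<Rightarrow> ereal" where
  "Sup0 S = (if S = {} then 0 else Sup S)"

definition fourier_dim_measure :: "real \<Rightarrow> 'a::euclidean_space measure \<Rightarrow> ereal" where
  "fourier_dim_measure \<theta> \<mu> = Sup0 {ereal s | s. fourier_energy s \<theta> \<mu> < \<infinity>}"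

definition fourier_dim :: "real \<Rightarrow> 'a::euclidean_space set \<Rightarrow> ereal" where
  "fourier_dim \<theta> X =
     Sup0 {min (fourier_dim_measure \<theta> \<mu>) (ereal (real DIM('a))) | \<mu>. \<mu> \<in> supported_measures X}"

end

theory Submission
  imports Defs "HOL-Probability.Characteristic_Functions"
begin

text \<open>
  Let \<open>\<mu>\<close> be a measure on \<open>X\<close> with \<open>\<J>\<^sub>s\<^sub>,\<^sub>\<theta>(\<mu>) < \<infinity>\<close> and \<open>s > t + (d - k)\<theta>\<close>. Since the support
  of \<open>\<mu>\<close> is bounded, the indicator of \<open>\<bar>P(x - y)\<bar> \<le> r\<close>, with \<open>P\<close> the projection to \<open>V\<close> and \<open>Q = 1 - P\<close>,
  is at most a constant times \<open>exp(-\<pi>(\<bar>P(x - y)\<bar>\<^sup>2/r\<^sup>2 + \<bar>Q(x - y)\<bar>\<^sup>2))\<close>. The double integral of this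
  Gaussian is \<open>r\<^sup>k \<integral> \<bar>\<mu>^(z)\<bar>\<^sup>2 w(z) dz\<close> with \<open>w(z) = exp(-\<pi>(r\<^sup>2\<bar>Pz\<bar>\<^sup>2 + \<bar>Qz\<bar>\<^sup>2))\<close>, so that \<open>\<mu>^\<close> never has
  to be restricted to \<open>V\<close>. Young's inequality with exponents \<open>1/\<theta>\<close> and \<open>1/(1 - \<theta>)\<close> separates the energy
  from an explicit integral of \<open>w\<close> and bounds the correlation
  \<open>(\<mu> \<times> \<mu>){\<bar>P(x - y)\<bar> \<le> r}\<close> by a multiple of a power of \<open>r\<close> with exponent larger than \<open>t\<close>.
  Hence the \<open>t\<close>-potential of the projected measure is finite almost everywhere, and the mass
  distribution principle shows that \<open>P(X)\<close> has positive \<open>t\<close>-dimensional Hausdorff measure.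
\<close>

subsection \<open>Rotations and Gaussians\<close>

lemma nn_integral_lborel_shift:
  fixes h :: "'a::euclidean_space \<Rightarrow> ennreal"
  assumes [measurable]: "h \<in> borel_measurable borel"
  shows "(\<integral>\<^sup>+x. h (a + x) \<partial>lborel) = (\<integral>\<^sup>+x. h x \<partial>lborel)"
proof -
  have "(\<integral>\<^sup>+x. h x \<partial>lborel) = (\<integral>\<^sup>+x. h x \<partial>distr lborel borel ((+) a))"
    using lborel_distr_plus[of a] by simp
  also have "\<dots> = (\<integral>\<^sup>+x. h (a + x) \<partial>lborel)"
    by (subst nn_integral_distr) auto
  finally show ?thesis by simp
qed

text \<open>Fubini for \<open>\<integral>\<integral> 1\<^sub>B(x) h(x + f w)\<close> with \<open>B\<close> the unit ball, which \<open>f\<close> preserves. The library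
  only has this for index types of class \<^class>\<open>wellorder\<close>.\<close>

lemma nn_integral_lborel_orthogonal_transformation:
  fixes h :: "'a::euclidean_space \<Rightarrow> ennreal"
  assumes f: "orthogonal_transformation (f :: 'a \<Rightarrow> 'a)" and h[measurable]: "h \<in> borel_measurable borel"
  shows "(\<integral>\<^sup>+x. h (f x) \<partial>lborel) = (\<integral>\<^sup>+x. h x \<partial>lborel)"
proof -
  have lin: "linear f" using f by (rule orthogonal_transformation_linear)
  have fm[measurable]: "f \<in> borel_measurable borel"
    using lin by (intro borel_measurable_continuous_onI linear_continuous_on)
      (simp add: linear_conv_bounded_linear)
  define A where "A = ball (0::'a) 1"
  have [measurable]: "A \<in> sets borel" by (simp add: A_def)
  have A0: "emeasure lborel A \<noteq> 0"
    using content_ball_pos[of 1 "0::'a"] unfolding A_def measure_def by (metis enn2real_0 less_irrefl zero_less_one)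
  have Af: "emeasure lborel A \<noteq> \<infinity>"
    unfolding A_def using emeasure_lborel_ball_finite[of 0 1] by (metis less_irrefl infinity_ennreal_def)
  \<comment> \<open>As \<open>f\<close> is a surjective isometry, the integrand is the indicator of
    the unit ball about the preimage of \<open>x\<close>, whose volume does not depend on
    \<open>x\<close>.\<close>
  have inv: "(\<integral>\<^sup>+w. indicator A (x - f w) \<partial>lborel) = emeasure lborel A" for x
  proof -
    obtain y where y: "x = f y"
      using orthogonal_transformation_surj[OF f] by (metis surjD)
    have "(\<integral>\<^sup>+w. indicator A (x - f w) \<partial>lborel) = (\<integral>\<^sup>+w. indicator A (- y + w) \<partial>lborel)"
    proof (intro nn_integral_cong)
      fix w
      have "norm (f y - f w) = norm (- y + w)"
        by (metis f lin linear_diff orthogonal_transformation_norm norm_minus_commute uminus_add_conv_diff)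
      then show "indicator A (x - f w) = (indicator A (- y + w) :: ennreal)"
        by (auto simp: y A_def indicator_def)
    qed
    also have "\<dots> = (\<integral>\<^sup>+w. indicator A w \<partial>lborel)"
      by (rule nn_integral_lborel_shift) simp
    finally show ?thesis by simp
  qed
  have shift: "(\<integral>\<^sup>+w. h (x + f w) \<partial>lborel) = (\<integral>\<^sup>+w. h (f w) \<partial>lborel)" for x
  proof -
    obtain y where y: "x = f y"
      using orthogonal_transformation_surj[OF f] by (metis surjD)
    show ?thesis
      using nn_integral_lborel_shift[of "\<lambda>w. h (f w)" y] lin by (simp add: y linear_add)
  qed
  \<comment> \<open>The two orders of integration give the volume of \<open>A\<close> times either
    side of the claim. This volume is positive and finite, so it cancels.\<close>
  have "emeasure lborel A * (\<integral>\<^sup>+w. h (f w) \<partial>lborel)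
      = (\<integral>\<^sup>+x. indicator A x * (\<integral>\<^sup>+w. h (f w) \<partial>lborel) \<partial>lborel)"
    by (simp add: nn_integral_multc)
  also have "\<dots> = (\<integral>\<^sup>+x. (\<integral>\<^sup>+w. indicator A x * h (x + f w) \<partial>lborel) \<partial>lborel)"
    by (intro nn_integral_cong) (simp add: nn_integral_cmult shift)
  also have "\<dots> = (\<integral>\<^sup>+w. (\<integral>\<^sup>+x. indicator A x * h (x + f w) \<partial>lborel) \<partial>lborel)"
    by (intro lborel_pair.Fubini') measurable
  also have "\<dots> = (\<integral>\<^sup>+w. (\<integral>\<^sup>+x. indicator A (x - f w) * h x \<partial>lborel) \<partial>lborel)"
  proof (rule nn_integral_cong)
    fix w
    show "(\<integral>\<^sup>+x. indicator A x * h (x + f w) \<partial>lborel) = (\<integral>\<^sup>+x. indicator A (x - f w) * h x \<partial>lborel)"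
      using nn_integral_lborel_shift[of "\<lambda>x. indicator A (x - f w) * h x" "f w"] by (simp add: add.commute)
  qed
  also have "\<dots> = (\<integral>\<^sup>+x. (\<integral>\<^sup>+w. indicator A (x - f w) * h x \<partial>lborel) \<partial>lborel)"
    by (intro lborel_pair.Fubini') measurable
  also have "\<dots> = (\<integral>\<^sup>+x. emeasure lborel A * h x \<partial>lborel)"
    by (intro nn_integral_cong) (simp add: nn_integral_multc inv)
  also have "\<dots> = emeasure lborel A * (\<integral>\<^sup>+x. h x \<partial>lborel)"
    by (simp add: nn_integral_cmult)
  finally show ?thesis
    using A0 Af by (metis ennreal_mult_cancel_left infinity_ennreal_def)
qed

section \<open>Fourier transforms of anisotropic Gaussians\<close>

lemma has_bochner_integral_gaussian_fourier:
  fixes c v :: real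
  assumes c: "c > 0"
  shows "has_bochner_integral lborel
    (\<lambda>x. exp (- 2 * of_real pi * \<i> * of_real (x * v)) * of_real (exp (- pi * c\<^sup>2 * x\<^sup>2)))
    (of_real (1 / c * exp (- pi * v\<^sup>2 / c\<^sup>2)) :: complex)"
proof -
  \<comment> \<open>The characteristic function of the standard normal law is rescaled:
    \<open>a\<close> turns the normal exponent into \<open>- pi * c\<^sup>2 * x\<^sup>2\<close>, and
    \<open>t\<close> is the frequency with \<open>t * a = - 2 * pi * v\<close>.\<close>
  define a where "a = sqrt (2 * pi) * c"
  define t where "t = - sqrt (2 * pi) * v / c"
  have a: "a > 0" using c by (simp add: a_def)
  have a2: "a\<^sup>2 = 2 * pi * c\<^sup>2" by (simp add: a_def power_mult_distrib)
  have at: "t * a = - 2 * pi * v" using c by (simp add: a_def t_def field_simps)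
  have t2: "t\<^sup>2 = 2 * pi * v\<^sup>2 / c\<^sup>2" by (simp add: t_def power_mult_distrib power_divide)
  let ?g = "\<lambda>x. std_normal_density x *\<^sub>R iexp (t * x)"
  have int: "integrable lborel ?g"
    by (rule Bochner_Integration.integrable_bound[of _ std_normal_density])
       (auto simp: integrable_std_normal_moment[of 0, simplified] integrable_normal_density)
  have val: "(\<integral>x. ?g x \<partial>lborel) = of_real (exp (- (t^2) / 2))"
    using fun_cong[OF char_std_normal_distribution, of t]
    by (simp add: char_def integral_density normal_density_nonneg)
  have eq: "?g (a * x) = of_real (1 / sqrt (2 * pi)) *
      (exp (- 2 * of_real pi * \<i> * of_real (x * v)) * of_real (exp (- pi * c\<^sup>2 * x\<^sup>2)))" for x
  proof -
    have e1: "- (a * x)\<^sup>2 / 2 = - pi * c\<^sup>2 * x\<^sup>2" by (simp add: power_mult_distrib a2)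
    have e2: "\<i> * complex_of_real (t * (a * x)) = - 2 * of_real pi * \<i> * of_real (x * v)"
      unfolding mult.assoc[symmetric] at by (simp add: mult_ac)
    show ?thesis unfolding std_normal_density_def e1 e2 by (simp add: scaleR_conv_of_real mult_ac)
  qed
  have i2: "integrable lborel (\<lambda>x. ?g (a * x))"
    using lborel_integrable_real_affine[OF int, of a 0] a by simp
  have v2: "(\<integral>x. ?g (a * x) \<partial>lborel) = of_real (exp (- (t^2) / 2)) / a"
    using lborel_integral_real_affine[of a ?g 0] a val
    by (simp add: scaleR_conv_of_real field_simps)
  have "has_bochner_integral lborel (\<lambda>x. ?g (a * x)) (of_real (exp (- (t^2) / 2) / a) :: complex)"
    using has_bochner_integral_integrable[OF i2] v2 by simp
  then have "has_bochner_integral lborel (\<lambda>x. complex_of_real (sqrt (2 * pi)) * ?g (a * x))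
     (complex_of_real (sqrt (2 * pi)) * complex_of_real (exp (- (t^2) / 2) / a))"
    by (rule has_bochner_integral_mult_right)
  moreover have "complex_of_real (sqrt (2 * pi)) * complex_of_real (exp (- (t^2) / 2) / a)
     = (of_real (1 / c * exp (- pi * v\<^sup>2 / c\<^sup>2)) :: complex)"
    unfolding t2 a_def using c by simp
  ultimately show ?thesis unfolding eq by simp
qed

text \<open>\<open>lborel\<close> is the image of a product of one-dimensional copies under the
  coordinate map, so a product of functions of single coordinates integrates factor by
  factor.\<close>

lemma has_bochner_integral_lborel_prod:
  fixes f :: "'a::euclidean_space \<Rightarrow> real \<Rightarrow> complex"
  assumes f: "\<And>b. b \<in> Basis \<Longrightarrow> has_bochner_integral lborel (f b) (I b)"
  shows "has_bochner_integral lborel (\<lambda>x. \<Prod>b\<in>Basis. f b (x \<bullet> b)) (\<Prod>b\<in>Basis. I b)"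
proof -
  interpret product_sigma_finite "\<lambda>_::'a. lborel :: real measure" ..
  have i: "integrable lborel (f b)" "integral\<^sup>L lborel (f b) = I b" if "b \<in> Basis" for b
    using f[OF that] by (auto simp: has_bochner_integral_iff)
  have m[measurable]: "(\<lambda>x. \<Prod>b\<in>Basis. f b (x \<bullet> b)) \<in> borel_measurable borel"
  proof (intro borel_measurable_prod)
    fix b :: 'a
    assume "b \<in> Basis"
    then have [measurable]: "f b \<in> borel_measurable borel"
      using borel_measurable_integrable[OF i(1)] by simp
    show "(\<lambda>x. f b (x \<bullet> b)) \<in> borel_measurable borel" by measurable
  qed
  have eq: "(\<Prod>b\<in>Basis. f b ((\<Sum>b\<in>Basis. x b *\<^sub>R b) \<bullet> b)) = (\<Prod>b\<in>Basis. f b (x b))" for x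
    by (intro prod.cong) auto
  show ?thesis
    unfolding has_bochner_integral_iff
    by (subst (1 2) lborel_eq)
       (simp add: integrable_distr_eq integral_distr eq product_integrable_prod product_integral_prod i)
qed

text \<open>The character factors over the coordinates as the Gaussian does. Each axis has its own
  scale \<open>c b\<close>, since later the scale is \<open>r\<close> along the subspace and 1
  across it.\<close>

lemma has_bochner_integral_gaussian_fourier_prod:
  fixes v :: "'a::euclidean_space"
  assumes c: "\<And>b. b \<in> Basis \<Longrightarrow> c b > 0"
  shows "has_bochner_integral lborel
    (\<lambda>z. exp (- 2 * of_real pi * \<i> * of_real (z \<bullet> v))
       * of_real (\<Prod>b\<in>Basis. exp (- pi * (c b)\<^sup>2 * (z \<bullet> b)\<^sup>2)))
    (of_real (\<Prod>b\<in>Basis. 1 / c b * exp (- pi * (v \<bullet> b)\<^sup>2 / (c b)\<^sup>2)) :: complex)"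
proof -
  have "exp (- 2 * of_real pi * \<i> * of_real (z \<bullet> v))
     = (\<Prod>b\<in>Basis. exp (- 2 * of_real pi * \<i> * of_real ((z \<bullet> b) * (v \<bullet> b))))" for z :: 'a
    unfolding exp_sum[OF finite_Basis, symmetric]
    by (subst euclidean_inner) (simp add: sum_distrib_left)
  then show ?thesis
    using has_bochner_integral_lborel_prod[OF has_bochner_integral_gaussian_fourier[OF c], of "\<lambda>b. b" "\<lambda>b. v \<bullet> b"]
    by (simp add: prod.distrib)
qed

subsection \<open>The Gaussian energy identity\<close>

lemma fourier_transform_measurable:
  fixes \<mu> :: "'a::euclidean_space measure"
  assumes fin: "finite_measure \<mu>" and [measurable_cong]: "sets \<mu> = sets borel"
  shows "fourier_transform \<mu> \<in> borel_measurable borel"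
proof -
  interpret finite_measure \<mu> by fact
  show ?thesis
    unfolding fourier_transform_def by (intro borel_measurable_lebesgue_integral) measurable
qed

lemma norm_fourier_transform_le:
  assumes "finite_measure \<mu>"
  shows "norm (fourier_transform \<mu> z) \<le> measure \<mu> (space \<mu>)"
proof -
  have "norm (fourier_transform \<mu> z)
      \<le> (\<integral>x. norm (exp (- 2 * complex_of_real pi * \<i> * complex_of_real (z \<bullet> x))) \<partial>\<mu>)"
    unfolding fourier_transform_def by (rule integral_norm_bound)
  then show ?thesis by simp
qed

text \<open>Fubini for the character at \<open>z\<close> of \<open>x - y\<close> times a Gaussian in
  \<open>z\<close>: integrating over \<open>z\<close> first gives the kernel on the left,
  integrating over \<open>x\<close> and \<open>y\<close> first gives the squared modulus on the
  right.\<close>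

lemma nn_integral_gaussian_energy:
  fixes \<mu> :: "'a::euclidean_space measure"
  assumes fin: "finite_measure \<mu>" and [measurable_cong]: "sets \<mu> = sets borel"
    and c: "\<And>b. b \<in> Basis \<Longrightarrow> c b > 0"
  shows "(\<integral>\<^sup>+x. \<integral>\<^sup>+y. ennreal (\<Prod>b\<in>Basis. 1 / c b * exp (- pi * ((x - y) \<bullet> b)\<^sup>2 / (c b)\<^sup>2)) \<partial>\<mu> \<partial>\<mu>)
    = (\<integral>\<^sup>+z. ennreal ((norm (fourier_transform \<mu> z))\<^sup>2
         * (\<Prod>b\<in>Basis. exp (- pi * (c b)\<^sup>2 * (z \<bullet> b)\<^sup>2))) \<partial>lborel)"
proof -
  interpret finite_measure \<mu> by fact
  interpret N: finite_measure "\<mu> \<Otimes>\<^sub>M \<mu>" by (intro finite_measure_pair_measure fin)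
  interpret Q: pair_sigma_finite \<mu> \<mu> ..
  interpret P: pair_sigma_finite "lborel :: 'a measure" "\<mu> \<Otimes>\<^sub>M \<mu>" ..
  define e :: "'a \<Rightarrow> 'a \<Rightarrow> complex"
    where "e z v = exp (- 2 * of_real pi * \<i> * of_real (z \<bullet> v))" for z v
  define g :: "'a \<Rightarrow> real" where "g z = (\<Prod>b\<in>Basis. exp (- pi * (c b)\<^sup>2 * (z \<bullet> b)\<^sup>2))" for z
  define G :: "'a \<Rightarrow> real"
    where "G v = (\<Prod>b\<in>Basis. 1 / c b * exp (- pi * (v \<bullet> b)\<^sup>2 / (c b)\<^sup>2))" for v
  define f where "f z p = e z (fst p - snd p) * of_real (g z)" for z p
  have ne[simp]: "norm (e z v) = 1" for z v by (simp add: e_def)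
  have g0: "g z \<ge> 0" for z by (auto simp: g_def intro!: prod_nonneg)
  have G0: "G z \<ge> 0" for z
    unfolding G_def using c by (intro prod_nonneg mult_nonneg_nonneg) (auto simp: less_imp_le)
  have [measurable]: "g \<in> borel_measurable borel" unfolding g_def by measurable
  have [measurable]: "G \<in> borel_measurable borel" unfolding G_def by measurable
  have [measurable]: "case_prod e \<in> borel_measurable (borel \<Otimes>\<^sub>M borel)" unfolding e_def by measurable
  have gauss: "has_bochner_integral lborel (\<lambda>z. e z v * of_real (g z)) (of_real (G v))" for v
    using has_bochner_integral_gaussian_fourier_prod[of c v] c unfolding e_def g_def G_def by blast
  \<comment> \<open>At \<open>v = 0\<close> the character is 1, so the transform formula contains
    the integrability of the Gaussian itself.\<close>
  have gint: "integrable lborel g"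
    using gauss[of 0] by (simp add: has_bochner_integral_iff e_def complex_of_real_integrable_eq)
  have fm[measurable]: "case_prod f \<in> borel_measurable (lborel \<Otimes>\<^sub>M (\<mu> \<Otimes>\<^sub>M \<mu>))"
    unfolding f_def by measurable
  \<comment> \<open>The modulus does not depend on the pair \<open>p\<close>; as
    \<open>\<mu>\<close> is finite, integrability of \<open>g\<close> gives joint
    integrability.\<close>
  have nf: "norm (f z p) = g z" for z p using g0 by (simp add: f_def norm_mult)
  have fint: "integrable (lborel \<Otimes>\<^sub>M (\<mu> \<Otimes>\<^sub>M \<mu>)) (case_prod f)"
  proof (rule P.Fubini_integrable)
    show "integrable lborel (\<lambda>z. \<integral>p. norm (case (z, p) of (z, p) \<Rightarrow> f z p) \<partial>(\<mu> \<Otimes>\<^sub>M \<mu>))"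
      using gint by (simp add: nf)
    show "AE z in lborel. integrable (\<mu> \<Otimes>\<^sub>M \<mu>) (\<lambda>p. case (z, p) of (z, p) \<Rightarrow> f z p)"
    proof (rule AE_I2)
      fix z
      show "integrable (\<mu> \<Otimes>\<^sub>M \<mu>) (\<lambda>p. case (z, p) of (z, p) \<Rightarrow> f z p)"
        by (rule N.integrable_const_bound[where B = "g z"]) (auto simp: nf f_def norm_mult g0)
    qed
  qed simp
  have FF: "(\<integral>p. f z p \<partial>(\<mu> \<Otimes>\<^sub>M \<mu>)) = of_real ((norm (fourier_transform \<mu> z))\<^sup>2 * g z)" for z
  proof -
    have i2: "integrable (\<mu> \<Otimes>\<^sub>M \<mu>) (\<lambda>p. e z (fst p - snd p))"
      by (intro N.integrable_const_bound[where B = 1]) auto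
    \<comment> \<open>The character of a difference is a product with a conjugate, whence the
      squared modulus of the transform.\<close>
    have sp: "e z (x - y) = e z x * cnj (e z y)" for x y
    proof -
      have "cnj (e z y) = exp (2 * of_real pi * \<i> * of_real (z \<bullet> y))"
        by (simp add: e_def exp_cnj)
      then show ?thesis
        by (simp add: e_def exp_add[symmetric] inner_diff_right algebra_simps)
    qed
    have "(\<integral>p. e z (fst p - snd p) \<partial>(\<mu> \<Otimes>\<^sub>M \<mu>)) = (\<integral>x. (\<integral>y. e z (x - y) \<partial>\<mu>) \<partial>\<mu>)"
      using Q.integral_fst'[OF i2] by simp
    also have "\<dots> = fourier_transform \<mu> z * cnj (fourier_transform \<mu> z)"
      unfolding sp by (simp add: fourier_transform_def e_def)
    also have "\<dots> = of_real ((norm (fourier_transform \<mu> z))\<^sup>2)"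
      by (metis complex_norm_square of_real_power)
    finally show ?thesis by (simp add: f_def)
  qed
  have i1: "integrable lborel (\<lambda>z. complex_of_real ((norm (fourier_transform \<mu> z))\<^sup>2 * g z))"
    using P.integrable_fst[OF fint] by (simp only: FF)
  have i1': "integrable lborel (\<lambda>z. (norm (fourier_transform \<mu> z))\<^sup>2 * g z)"
    using i1 complex_of_real_integrable_eq by blast
  have GG: "(\<integral>z. f z p \<partial>lborel) = of_real (G (fst p - snd p))" for p
    using gauss by (simp add: f_def has_bochner_integral_iff)
  have i3: "integrable (\<mu> \<Otimes>\<^sub>M \<mu>) (\<lambda>p. complex_of_real (G (fst p - snd p)))"
    using P.integrable_snd[OF fint] by (simp only: GG)
  have i3': "integrable (\<mu> \<Otimes>\<^sub>M \<mu>) (\<lambda>p. G (fst p - snd p))"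
    using i3 complex_of_real_integrable_eq by blast
  have "complex_of_real (\<integral>p. G (fst p - snd p) \<partial>(\<mu> \<Otimes>\<^sub>M \<mu>))
      = of_real (\<integral>z. (norm (fourier_transform \<mu> z))\<^sup>2 * g z \<partial>lborel)"
    using P.Fubini_integral[OF fint] unfolding FF GG by (simp only: integral_complex_of_real)
  then have eq: "(\<integral>p. G (fst p - snd p) \<partial>(\<mu> \<Otimes>\<^sub>M \<mu>)) = (\<integral>z. (norm (fourier_transform \<mu> z))\<^sup>2 * g z \<partial>lborel)"
    by (simp only: of_real_eq_iff)
  have "(\<integral>\<^sup>+x. \<integral>\<^sup>+y. ennreal (G (x - y)) \<partial>\<mu> \<partial>\<mu>) = (\<integral>\<^sup>+p. ennreal (G (fst p - snd p)) \<partial>(\<mu> \<Otimes>\<^sub>M \<mu>))"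
    by (subst nn_integral_fst[symmetric]) auto
  also have "\<dots> = ennreal (\<integral>p. G (fst p - snd p) \<partial>(\<mu> \<Otimes>\<^sub>M \<mu>))"
    using i3' G0 by (intro nn_integral_eq_integral) auto
  also have "\<dots> = (\<integral>\<^sup>+z. ennreal ((norm (fourier_transform \<mu> z))\<^sup>2 * g z) \<partial>lborel)"
    unfolding eq using i1' g0 by (intro nn_integral_eq_integral[symmetric]) auto
  finally show ?thesis by (simp add: G_def g_def)
qed

section \<open>One-dimensional Gaussian integrals\<close>

lemma nn_integral_scale:
  fixes f :: "real \<Rightarrow> ennreal"
  assumes [measurable]: "f \<in> borel_measurable borel" and r: "r > 0"
  shows "(\<integral>\<^sup>+x. f (r * x) \<partial>lborel) = ennreal (1 / r) * (\<integral>\<^sup>+x. f x \<partial>lborel)"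
proof -
  have "ennreal (1 / r) * (\<integral>\<^sup>+x. f x \<partial>lborel) = ennreal (1 / r) * (ennreal r * (\<integral>\<^sup>+x. f (r * x) \<partial>lborel))"
    using nn_integral_real_affine[of f r 0] r by simp
  also have "\<dots> = (\<integral>\<^sup>+x. f (r * x) \<partial>lborel)"
    using r by (simp add: mult.assoc[symmetric] ennreal_mult[symmetric])
  finally show ?thesis by simp
qed

lemma nn_integral_gaussian_finite:
  assumes "p > 0"
  shows "(\<integral>\<^sup>+x. ennreal (exp (- p * x\<^sup>2)) \<partial>lborel) < \<infinity>"
proof -
  have "integrable lborel (\<lambda>x. exp (- p * x\<^sup>2))"
    using has_bochner_integral_gaussian_fourier[of "sqrt (p / pi)" 0] assms
    by (simp add: has_bochner_integral_iff complex_of_real_integrable_eq del: of_real_exp)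
  then show ?thesis by (simp add: integrable_iff_bounded)
qed

text \<open>On \<open>[-1, 1]\<close> the Gaussian is at most 1 and \<open>b < 1\<close> makes the
  power integrable; elsewhere the power is at most 1 and the Gaussian is integrable.\<close>

lemma nn_integral_powr_gaussian_finite:
  assumes b: "0 \<le> b" "b < 1" and p: "p > 0"
  shows "(\<integral>\<^sup>+x. ennreal (\<bar>x\<bar> powr (- b) * exp (- p * x\<^sup>2)) \<partial>lborel) < \<infinity>"
proof -
  let ?h = "\<lambda>x. ennreal (x powr (- b)) * indicator {0..1} x"
  have h: "integral\<^sup>N lborel ?h < \<infinity>"
    using nn_integral_has_integral_lebesgue'[OF _ has_integral_powr_from_0[of "- b" 1]] b by simp
  have hm[measurable]: "?h \<in> borel_measurable borel" by measurable
  have hneg: "(\<integral>\<^sup>+x. ?h (- x) \<partial>lborel) = integral\<^sup>N lborel ?h"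
    using nn_integral_real_affine[OF hm, of "- 1" 0] by simp
  have "(\<integral>\<^sup>+x. ennreal (\<bar>x\<bar> powr (- b) * exp (- p * x\<^sup>2)) \<partial>lborel)
     \<le> (\<integral>\<^sup>+x. (?h x + ?h (- x)) + ennreal (exp (- p * x\<^sup>2)) \<partial>lborel)"
  proof (intro nn_integral_mono)
    fix x :: real
    consider "0 \<le> x" "x \<le> 1" | "- 1 \<le> x" "x < 0" | "\<bar>x\<bar> > 1" by linarith
    then show "ennreal (\<bar>x\<bar> powr (- b) * exp (- p * x\<^sup>2)) \<le> (?h x + ?h (- x)) + ennreal (exp (- p * x\<^sup>2))"
    proof cases
      case 1
      then have "ennreal (\<bar>x\<bar> powr (- b) * exp (- p * x\<^sup>2)) \<le> ?h x"
        using p by (auto intro!: ennreal_leI mult_left_le)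
      then show ?thesis by (simp add: add_increasing2)
    next
      case 2
      then have "ennreal (\<bar>x\<bar> powr (- b) * exp (- p * x\<^sup>2)) \<le> ?h (- x)"
        using p by (auto intro!: ennreal_leI mult_left_le)
      then show ?thesis by (simp add: add_increasing2 add_increasing)
    next
      case 3
      then have "\<bar>x\<bar> powr (- b) \<le> 1" using b powr_mono[of "- b" 0 "\<bar>x\<bar>"] by (simp split: if_splits)
      then have "ennreal (\<bar>x\<bar> powr (- b) * exp (- p * x\<^sup>2)) \<le> ennreal (exp (- p * x\<^sup>2))"
        by (intro ennreal_leI) (simp add: mult_left_le_one_le)
      then show ?thesis by (simp add: add_increasing)
    qed
  qed
  also have "\<dots> = integral\<^sup>N lborel ?h + integral\<^sup>N lborel ?h + (\<integral>\<^sup>+x. ennreal (exp (- p * x\<^sup>2)) \<partial>lborel)"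
    by (simp add: nn_integral_add hneg)
  also have "\<dots> < \<infinity>" using h nn_integral_gaussian_finite[OF p] by simp
  finally show ?thesis .
qed

subsection \<open>Powers integrated against a Gaussian\<close>

text \<open>With \<open>V\<close> rotated to the span of \<open>S\<close>, this is the Gaussian
  weight \<open>w\<close> on the frequency side. It is concentrated on a slab of length about
  \<open>1 / r\<close> along \<open>V\<close> and about 1 across it; the product form suits
  integration coordinate by coordinate.\<close>

definition slab_weight :: "'a::euclidean_space set \<Rightarrow> real \<Rightarrow> 'a \<Rightarrow> real" where
  "slab_weight S r z = (\<Prod>b\<in>Basis. exp (- pi * (if b \<in> S then r else 1)\<^sup>2 * (z \<bullet> b)\<^sup>2))"

lemma slab_weight_measurable[measurable]: "slab_weight S r \<in> borel_measurable borel"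
  unfolding slab_weight_def by measurable

lemma slab_weight_nonneg: "0 \<le> slab_weight S r z"
  unfolding slab_weight_def by (intro prod_nonneg) auto

lemma slab_weight_le_1: "slab_weight S r z \<le> 1"
  unfolding slab_weight_def by (intro prod_le_1) auto

lemma prod_Basis_if:
  assumes "S \<subseteq> (Basis :: 'a::euclidean_space set)"
  shows "(\<Prod>b\<in>Basis. if b \<in> S then f b else 1) = prod f S"
  using assms by (simp add: prod.inter_restrict[symmetric] Int_absorb1)

text \<open>With k = \<open>card S\<close>, the decay is shared equally among the coordinates in
  \<open>S\<close>: where \<open>norm z\<close> is at least 1 it dominates each
  \<open>max 1 \<bar>z \<bullet> b\<bar>\<close>, so \<open>norm z powr (- a)\<close> is at most a
  product of k powers with exponent \<open>- a / k\<close>. As \<open>a / k < 1\<close>, each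
  one-dimensional integral is finite and scales like \<open>r powr (a / k - 1)\<close>.\<close>

lemma slab_integral_nonneg_exponent:
  fixes S :: "'a::euclidean_space set"
  assumes S: "S \<subseteq> Basis" and a: "0 \<le> a" "a < real (card S)"
  shows "\<exists>C. \<forall>r. 0 < r \<and> r \<le> 1 \<longrightarrow>
    (\<integral>\<^sup>+z. ennreal (norm z powr (- a) * slab_weight S r z) * indicator {z. 1 \<le> norm z} z \<partial>lborel)
      \<le> ennreal (C * r powr (a - real (card S)))"
proof -
  have finS: "finite S" using S finite_subset finite_Basis by blast
  define k where "k = real (card S)"
  have k: "k > 0" using a by (simp add: k_def)
  define \<beta> where "\<beta> = a / k"
  have \<beta>: "0 \<le> \<beta>" "\<beta> < 1" and \<beta>k: "\<beta> * k = a" using a k by (auto simp: \<beta>_def k_def)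
  define h where "h x = \<bar>x\<bar> powr (- \<beta>) * exp (- pi * x\<^sup>2)" for x :: real
  have [measurable]: "h \<in> borel_measurable borel" unfolding h_def by measurable
  define I where "I = enn2real (\<integral>\<^sup>+x. ennreal (h x) \<partial>lborel)"
  define J where "J = enn2real (\<integral>\<^sup>+x. ennreal (exp (- pi * x\<^sup>2)) \<partial>lborel)"
  define D where "D = I + J"
  have I: "(\<integral>\<^sup>+x. ennreal (h x) \<partial>lborel) = ennreal I"
    unfolding I_def h_def using nn_integral_powr_gaussian_finite[OF \<beta>, of pi] by simp
  have J: "(\<integral>\<^sup>+x. ennreal (exp (- pi * x\<^sup>2)) \<partial>lborel) = ennreal J"
    unfolding J_def using nn_integral_gaussian_finite[of pi] by simp
  have D: "I \<le> D" "J \<le> D" "0 \<le> D" "0 \<le> I" "0 \<le> J" by (auto simp: D_def I_def J_def)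
  show ?thesis
  proof (intro exI[of _ "D ^ DIM('a)"] allI impI)
    fix r :: real assume r: "0 < r \<and> r \<le> 1"
    define \<phi> where "\<phi> b x = (if b \<in> S then max 1 \<bar>x\<bar> powr (- \<beta>) * exp (- pi * r\<^sup>2 * x\<^sup>2) else exp (- pi * x\<^sup>2))"
      for b :: 'a and x :: real
    have [measurable]: "\<phi> b \<in> borel_measurable borel" for b unfolding \<phi>_def by measurable
    have \<phi>0: "\<phi> b x \<ge> 0" for b x by (simp add: \<phi>_def)
    have int: "(\<integral>\<^sup>+x. ennreal (\<phi> b x) \<partial>lborel) \<le> ennreal ((if b \<in> S then r powr (\<beta> - 1) else 1) * D)" for b
    proof (cases "b \<in> S")
      case True
      have "(\<integral>\<^sup>+x. ennreal (\<phi> b x) \<partial>lborel) \<le> (\<integral>\<^sup>+x. ennreal (r powr \<beta>) * ennreal (h (r * x)) \<partial>lborel)"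
      proof (rule nn_integral_mono_AE)
        \<comment> \<open>The bound fails at \<open>x = 0\<close>, where
          \<open>0 powr (- \<beta>) = 0\<close> makes the right side vanish; a single point is a
          null set.\<close>
        have "AE x in lborel. x \<noteq> (0::real)" by (rule AE_lborel_singleton)
        then show "AE x in lborel. ennreal (\<phi> b x) \<le> ennreal (r powr \<beta>) * ennreal (h (r * x))"
        proof eventually_elim
          case (elim x)
          have "max 1 \<bar>x\<bar> powr (- \<beta>) \<le> \<bar>x\<bar> powr (- \<beta>)"
            using elim \<beta> by (intro powr_mono2') auto
          also have "\<dots> = r powr \<beta> * \<bar>r * x\<bar> powr (- \<beta>)"
            using r by (simp add: abs_mult powr_mult powr_minus field_simps)
          finally have "\<phi> b x \<le> r powr \<beta> * h (r * x)"
            using True by (simp add: \<phi>_def h_def power_mult_distrib mult.assoc[symmetric] mult_right_mono)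
          then show ?case by (simp add: ennreal_mult'[symmetric] ennreal_leI)
        qed
      qed
      also have "\<dots> = ennreal (r powr \<beta>) * (ennreal (1 / r) * ennreal I)"
        using nn_integral_scale[of "\<lambda>x. ennreal (h x)" r] r by (simp add: nn_integral_cmult I)
      also have "\<dots> = ennreal (r powr (\<beta> - 1) * I)"
        using r D by (simp add: ennreal_mult[symmetric] powr_diff)
      also have "\<dots> \<le> ennreal (r powr (\<beta> - 1) * D)"
        using D by (intro ennreal_leI mult_left_mono) auto
      finally show ?thesis using True by simp
    next
      case False
      then show ?thesis using D J by (simp add: \<phi>_def ennreal_leI)
    qed
    have pt: "ennreal (norm z powr (- a) * slab_weight S r z) * indicator {z. 1 \<le> norm z} z
        \<le> (\<Prod>b\<in>Basis. ennreal (\<phi> b (z \<bullet> b)))" for z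
    proof (cases "1 \<le> norm z")
      case True
      have "norm z powr (- a) = (\<Prod>b\<in>S. norm z powr (- \<beta>))"
      proof -
        have "norm z powr (- a) = (norm z powr (- \<beta>)) powr k" by (simp add: powr_powr \<beta>k)
        also have "\<dots> = (norm z powr (- \<beta>)) ^ card S"
          unfolding k_def using True by (intro powr_realpow) auto
        finally show ?thesis by simp
      qed
      also have "\<dots> \<le> (\<Prod>b\<in>S. max 1 \<bar>z \<bullet> b\<bar> powr (- \<beta>))"
      proof (intro prod_mono conjI powr_mono2')
        fix b assume "b \<in> S"
        then have "norm b = 1" using S by auto
        then show "max 1 \<bar>z \<bullet> b\<bar> \<le> norm z" using True Cauchy_Schwarz_ineq2[of z b] by simp
      qed (use \<beta> in auto)
      finally have "norm z powr (- a) * slab_weight S r z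
          \<le> (\<Prod>b\<in>S. max 1 \<bar>z \<bullet> b\<bar> powr (- \<beta>)) * slab_weight S r z"
        by (intro mult_right_mono slab_weight_nonneg)
      also have "\<dots> = (\<Prod>b\<in>Basis. \<phi> b (z \<bullet> b))"
        unfolding slab_weight_def prod_Basis_if[OF S, symmetric] prod.distrib[symmetric]
        by (intro prod.cong) (auto simp: \<phi>_def)
      finally show ?thesis using True \<phi>0 by (simp add: prod_ennreal ennreal_leI)
    qed simp
    have "(\<integral>\<^sup>+z. ennreal (norm z powr (- a) * slab_weight S r z) * indicator {z. 1 \<le> norm z} z \<partial>lborel)
      \<le> (\<integral>\<^sup>+z. (\<Prod>b\<in>Basis. ennreal (\<phi> b (z \<bullet> b))) \<partial>lborel)"
      by (intro nn_integral_mono pt)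
    also have "\<dots> = (\<Prod>b\<in>Basis. (\<integral>\<^sup>+x. ennreal (\<phi> b x) \<partial>lborel))"
      by (intro nn_integral_lborel_prod) auto
    also have "\<dots> \<le> (\<Prod>b\<in>(Basis::'a set). ennreal ((if b \<in> S then r powr (\<beta> - 1) else 1) * D))"
      by (intro prod_mono_ennreal int)
    also have "\<dots> = ennreal ((\<Prod>b\<in>S. r powr (\<beta> - 1)) * D ^ DIM('a))"
      using D by (simp add: prod_ennreal prod.distrib prod_Basis_if[OF S])
    also have "(\<Prod>b\<in>S. r powr (\<beta> - 1)) = r powr (a - k)"
      using r \<beta>k by (simp add: powr_realpow[symmetric] powr_powr k_def[symmetric] powr_power algebra_simps)
    finally show "(\<integral>\<^sup>+z. ennreal (norm z powr (- a) * slab_weight S r z) * indicator {z. 1 \<le> norm z} z \<partial>lborel)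
      \<le> ennreal (D ^ DIM('a) * r powr (a - real (card S)))"
      by (simp add: k_def mult.commute)
  qed
qed

text \<open>Half of the Gaussian exponent absorbs the growing power: \<open>r \<le> 1\<close> bounds
  \<open>r * norm z\<close> by the square root of the quadratic form in the exponent, which costs
  \<open>r powr (- m)\<close>. The other half integrates to a constant times \<open>1 / r\<close>
  for each direction in \<open>S\<close>.\<close>

lemma slab_integral_neg_exponent:
  fixes S :: "'a::euclidean_space set"
  assumes S: "S \<subseteq> Basis" and m: "0 \<le> m"
  shows "\<exists>C. \<forall>r. 0 < r \<and> r \<le> 1 \<longrightarrow>
    (\<integral>\<^sup>+z. ennreal (norm z powr m * slab_weight S r z) \<partial>lborel)
      \<le> ennreal (C * r powr (- m - real (card S)))"
proof -
  \<comment> \<open>This constant comes from completing the square in \<open>m * ln x \<le> m * x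
    \<le> pi / 2 * x\<^sup>2 + m\<^sup>2 / (2 * pi)\<close>.\<close>
  define K where "K = exp (m\<^sup>2 / (2 * pi))"
  define J where "J = enn2real (\<integral>\<^sup>+x. ennreal (exp (- (pi / 2) * x\<^sup>2)) \<partial>lborel)"
  have J: "(\<integral>\<^sup>+x. ennreal (exp (- (pi / 2) * x\<^sup>2)) \<partial>lborel) = ennreal J"
    unfolding J_def using nn_integral_gaussian_finite[of "pi / 2"] by simp
  have J0: "0 \<le> J" by (simp add: J_def)
  have powr_le: "x powr m \<le> K * exp (pi / 2 * x\<^sup>2)" if "x \<ge> 0" for x
  proof (cases "x = 0")
    case False
    then have "x > 0" using that by simp
    then have "m * ln x \<le> m * x" using m ln_le_minus_one[of x] by (intro mult_left_mono) auto
    moreover have "0 \<le> pi / 2 * (x - m / pi)\<^sup>2" by simp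
    moreover have "pi / 2 * (x - m / pi)\<^sup>2 = pi / 2 * x\<^sup>2 - m * x + m\<^sup>2 / (2 * pi)"
      by (simp add: power2_eq_square field_simps)
    ultimately have "m * ln x \<le> m\<^sup>2 / (2 * pi) + pi / 2 * x\<^sup>2" by linarith
    then show ?thesis using False by (simp add: powr_def K_def exp_add[symmetric])
  qed (simp add: K_def)
  show ?thesis
  proof (intro exI[of _ "K * J ^ DIM('a)"] allI impI)
    fix r :: real assume r: "0 < r \<and> r \<le> 1"
    define c where "c b = (if b \<in> S then r else 1)" for b
    have c: "c b > 0" "r \<le> c b" for b using r by (auto simp: c_def)
    have pt: "norm z powr m * slab_weight S r z
        \<le> r powr (- m) * K * (\<Prod>b\<in>Basis. exp (- (pi / 2) * (c b * (z \<bullet> b))\<^sup>2))" for z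
    proof -
      define n2 where "n2 = (\<Sum>b\<in>Basis. (c b)\<^sup>2 * (z \<bullet> b)\<^sup>2)"
      have n20: "n2 \<ge> 0" unfolding n2_def by (intro sum_nonneg) auto
      have w: "slab_weight S r z = exp (- pi * n2)"
        by (simp add: slab_weight_def n2_def c_def exp_sum[symmetric] sum_distrib_left sum_negf mult.assoc)
      have w2: "(\<Prod>b\<in>Basis. exp (- (pi / 2) * (c b * (z \<bullet> b))\<^sup>2)) = exp (- (pi / 2) * n2)"
        by (simp add: n2_def exp_sum[symmetric] sum_distrib_left sum_negf power_mult_distrib)
      have "(norm z)\<^sup>2 = (\<Sum>b\<in>Basis. (z \<bullet> b)\<^sup>2)"
        unfolding power2_norm_eq_inner by (subst euclidean_inner) (simp add: power2_eq_square)
      then have "(r * norm z)\<^sup>2 = (\<Sum>b\<in>Basis. r\<^sup>2 * (z \<bullet> b)\<^sup>2)"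
        by (simp add: power_mult_distrib sum_distrib_left)
      also have "\<dots> \<le> n2"
        unfolding n2_def using r c by (intro sum_mono mult_right_mono power_mono) auto
      finally have "r * norm z \<le> sqrt n2" by (intro real_le_rsqrt)
      then have "norm z \<le> sqrt n2 / r" using r by (simp add: field_simps)
      then have "norm z powr m \<le> (sqrt n2 / r) powr m" using m by (intro powr_mono2) auto
      also have "\<dots> = r powr (- m) * sqrt n2 powr m"
        using r n20 by (simp add: powr_divide powr_minus field_simps)
      also have "\<dots> \<le> r powr (- m) * (K * exp (pi / 2 * n2))"
        using powr_le[of "sqrt n2"] n20 by (intro mult_left_mono) auto
      finally have "norm z powr m * slab_weight S r z \<le> r powr (- m) * (K * exp (pi / 2 * n2)) * exp (- pi * n2)"
        unfolding w by (intro mult_right_mono) auto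
      also have "\<dots> = r powr (- m) * K * exp (- (pi / 2) * n2)"
        by (simp add: mult.assoc exp_add[symmetric] field_simps)
      finally show ?thesis unfolding w2 .
    qed
    have "(\<integral>\<^sup>+z. ennreal (norm z powr m * slab_weight S r z) \<partial>lborel)
      \<le> (\<integral>\<^sup>+z. ennreal (r powr (- m) * K) * (\<Prod>b\<in>Basis. ennreal (exp (- (pi / 2) * (c b * (z \<bullet> b))\<^sup>2))) \<partial>lborel)"
      using pt by (intro nn_integral_mono) (simp add: prod_ennreal ennreal_mult'[symmetric] K_def ennreal_leI)
    also have "\<dots> = ennreal (r powr (- m) * K) * (\<Prod>b\<in>Basis. (\<integral>\<^sup>+x. ennreal (exp (- (pi / 2) * (c b * x)\<^sup>2)) \<partial>lborel))"
      using nn_integral_lborel_prod[of "\<lambda>b x. ennreal (exp (- (pi / 2) * (c b * x)\<^sup>2))"]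
      by (subst nn_integral_cmult) simp_all
    also have "\<dots> = ennreal (r powr (- m) * K) * (\<Prod>b\<in>(Basis::'a set). ennreal ((if b \<in> S then 1 / r else 1) * J))"
    proof (intro arg_cong2[where f = "(*)"] refl prod.cong)
      fix b :: 'a
      show "(\<integral>\<^sup>+x. ennreal (exp (- (pi / 2) * (c b * x)\<^sup>2)) \<partial>lborel) = ennreal ((if b \<in> S then 1 / r else 1) * J)"
        using nn_integral_scale[of "\<lambda>x. ennreal (exp (- (pi / 2) * x\<^sup>2))" "c b"] c(1)[of b] J J0 r
        by (auto simp: ennreal_mult[symmetric] c_def)
    qed
    also have "\<dots> = ennreal (r powr (- m) * K * ((\<Prod>b\<in>S. 1 / r) * J ^ DIM('a)))"
      using J0 r by (simp add: prod_ennreal prod.distrib prod_Basis_if[OF S] ennreal_mult[symmetric] K_def)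
    also have "(\<Prod>b\<in>S. 1 / r) = r powr (- real (card S))"
      using r by (simp add: powr_realpow powr_minus power_divide field_simps)
    also have "r powr (- m) * K * (r powr (- real (card S)) * J ^ DIM('a))
        = K * J ^ DIM('a) * r powr (- m - real (card S))"
      by (simp add: powr_diff powr_minus field_simps)
    finally show "(\<integral>\<^sup>+z. ennreal (norm z powr m * slab_weight S r z) \<partial>lborel)
      \<le> ennreal (K * J ^ DIM('a) * r powr (- m - real (card S)))" .
  qed
qed

text \<open>Both signs of \<open>a\<close> are needed, because the exponent
  \<open>\<sigma> * q\<close> left over by Young's inequality is negative when
  \<open>t < k * \<theta>\<close>.\<close>

lemma slab_integral_bound:
  fixes S :: "'a::euclidean_space set"
  assumes S: "S \<subseteq> Basis" and a: "a < real (card S)"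
  obtains C where "C \<ge> 0" "\<And>r. 0 < r \<Longrightarrow> r \<le> 1 \<Longrightarrow>
    (\<integral>\<^sup>+z. ennreal (norm z powr (- a) * slab_weight S r z) * indicator {z. 1 \<le> norm z} z \<partial>lborel)
      \<le> ennreal (C * r powr (a - real (card S)))"
proof -
  have "\<exists>C. \<forall>r. 0 < r \<and> r \<le> 1 \<longrightarrow>
    (\<integral>\<^sup>+z. ennreal (norm z powr (- a) * slab_weight S r z) * indicator {z. 1 \<le> norm z} z \<partial>lborel)
      \<le> ennreal (C * r powr (a - real (card S)))"
  proof (cases "0 \<le> a")
    case True
    then show ?thesis using slab_integral_nonneg_exponent[OF S _ a] by blast
  next
    case False
    then obtain C where C: "\<And>r. 0 < r \<and> r \<le> 1 \<Longrightarrow>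
      (\<integral>\<^sup>+z. ennreal (norm z powr (- a) * slab_weight S r z) \<partial>lborel) \<le> ennreal (C * r powr (a - real (card S)))"
      using slab_integral_neg_exponent[OF S, of "- a"] by auto
    have "(\<integral>\<^sup>+z. ennreal (norm z powr (- a) * slab_weight S r z) * indicator {z. 1 \<le> norm z} z \<partial>lborel)
       \<le> (\<integral>\<^sup>+z. ennreal (norm z powr (- a) * slab_weight S r z) \<partial>lborel)" for r
      by (intro nn_integral_mono) (auto simp: indicator_def)
    then show ?thesis using C by (meson order_trans)
  qed
  then obtain C where C: "\<And>r. 0 < r \<Longrightarrow> r \<le> 1 \<Longrightarrow>
    (\<integral>\<^sup>+z. ennreal (norm z powr (- a) * slab_weight S r z) * indicator {z. 1 \<le> norm z} z \<partial>lborel)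
      \<le> ennreal (C * r powr (a - real (card S)))" by blast
  show thesis
  proof (rule that[of "\<bar>C\<bar>"])
    fix r :: real assume "0 < r" "r \<le> 1"
    then show "(\<integral>\<^sup>+z. ennreal (norm z powr (- a) * slab_weight S r z) * indicator {z. 1 \<le> norm z} z \<partial>lborel)
      \<le> ennreal (\<bar>C\<bar> * r powr (a - real (card S)))"
      by (intro order_trans[OF C[of r]] ennreal_leI mult_right_mono) auto
  qed simp
qed

subsection \<open>From Fourier energy to correlation\<close>

text \<open>On the unit ball the transform is bounded by the total mass. Outside, Young's inequality
  (for \<theta> = 0 the pointwise bound from the supremum) splits the integrand into an energy part
  and a power against the slab weight, both of order \<open>r powr (t - k)\<close>.\<close>

lemma weighted_energy_bound:
  fixes \<mu> :: "'a::euclidean_space measure" and S :: "'a set"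
  assumes fin: "finite_measure \<mu>" and sets[measurable_cong]: "sets \<mu> = sets borel"
    and S: "S \<subseteq> Basis" and \<theta>: "0 \<le> \<theta>" "\<theta> < 1"
    and t: "t < real (card S)" "t + (real DIM('a) - real (card S)) * \<theta> \<le> s"
    and energy: "fourier_energy s \<theta> \<mu> < \<infinity>"
  obtains C where "C \<ge> 0" "\<And>r. 0 < r \<Longrightarrow> r \<le> 1 \<Longrightarrow>
    (\<integral>\<^sup>+z. ennreal ((norm (fourier_transform \<mu> z))\<^sup>2 * slab_weight S r z) \<partial>lborel)
      \<le> ennreal (C * r powr (t - real (card S)))"
proof -
  define k where "k = real (card S)"
  define F where "F z = norm (fourier_transform \<mu> z)" for z
  have [measurable]: "fourier_transform \<mu> \<in> borel_measurable borel"
    by (rule fourier_transform_measurable[OF fin sets])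
  have [measurable]: "F \<in> borel_measurable borel" unfolding F_def by measurable
  have F0: "F z \<ge> 0" for z by (simp add: F_def)
  define M where "M = measure \<mu> (space \<mu>)"
  have FM: "F z \<le> M" for z unfolding F_def M_def by (rule norm_fourier_transform_le[OF fin])
  define A where "A = {z :: 'a. 1 \<le> norm z}"
  have [measurable]: "A \<in> sets borel" unfolding A_def by measurable
  define V where "V = measure lborel (ball (0::'a) 1)"
  have V: "emeasure lborel (ball (0::'a) 1) = ennreal V"
    unfolding V_def using emeasure_lborel_ball_finite[of "0::'a" 1]
    by (intro emeasure_eq_ennreal_measure) (simp add: less_top)
  have "\<exists>C\<ge>0. \<forall>r. 0 < r \<and> r \<le> 1 \<longrightarrow>
    (\<integral>\<^sup>+z. ennreal ((F z)\<^sup>2 * slab_weight S r z) * indicator A z \<partial>lborel) \<le> ennreal (C * r powr (t - k))"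
  proof (cases "\<theta> = 0")
    case True
    then have "(SUP z. ennreal ((F z)\<^sup>2 * norm z powr s)) < \<infinity>"
      using energy by (simp add: fourier_energy_def F_def)
    then obtain K where K: "(SUP z. ennreal ((F z)\<^sup>2 * norm z powr s)) = ennreal K" "K \<ge> 0"
      by (cases "SUP z. ennreal ((F z)\<^sup>2 * norm z powr s)") auto
    have FK: "(F z)\<^sup>2 * norm z powr s \<le> K" for z
    proof -
      have "ennreal ((F z)\<^sup>2 * norm z powr s) \<le> ennreal K" unfolding K(1)[symmetric] by (rule SUP_upper) simp
      then show ?thesis using K(2) by simp
    qed
    obtain C where C: "C \<ge> 0" "\<And>r. 0 < r \<Longrightarrow> r \<le> 1 \<Longrightarrow>
      (\<integral>\<^sup>+z. ennreal (norm z powr (- t) * slab_weight S r z) * indicator A z \<partial>lborel) \<le> ennreal (C * r powr (t - k))"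
      using slab_integral_bound[OF S t(1)] unfolding A_def k_def by blast
    \<comment> \<open>At \<theta> = 0 the hypothesis reads \<open>t \<le> s\<close>, so the decay
      \<open>norm z powr (- s)\<close> may be weakened to \<open>norm z powr (- t)\<close> where
      \<open>norm z\<close> is at least 1.\<close>
    have pt: "(F z)\<^sup>2 * slab_weight S r z \<le> K * (norm z powr (- t) * slab_weight S r z)" if "z \<in> A" for z r
    proof -
      have z: "1 \<le> norm z" using that by (simp add: A_def)
      then have "z \<noteq> 0" by auto
      then have "(F z)\<^sup>2 = ((F z)\<^sup>2 * norm z powr s) * norm z powr (- s)"
        by (simp add: powr_minus field_simps)
      also have "\<dots> \<le> K * norm z powr (- t)"
        using FK[of z] K(2) z t True by (intro mult_mono powr_mono) auto
      finally show ?thesis using slab_weight_nonneg[of S r z] by (simp add: mult_right_mono mult.assoc[symmetric])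
    qed
    show ?thesis
    proof (intro exI[of _ "K * C"] conjI allI impI)
      fix r :: real assume r: "0 < r \<and> r \<le> 1"
      have "(\<integral>\<^sup>+z. ennreal ((F z)\<^sup>2 * slab_weight S r z) * indicator A z \<partial>lborel)
        \<le> (\<integral>\<^sup>+z. ennreal K * (ennreal (norm z powr (- t) * slab_weight S r z) * indicator A z) \<partial>lborel)"
        using pt K(2) by (intro nn_integral_mono) (auto simp: indicator_def ennreal_mult'[symmetric] intro!: ennreal_leI)
      also have "\<dots> \<le> ennreal K * ennreal (C * r powr (t - k))"
        using C(2)[of r] r by (subst nn_integral_cmult) (auto intro: mult_left_mono)
      also have "\<dots> = ennreal (K * C * r powr (t - k))"
        using K C by (simp add: ennreal_mult[symmetric] mult.assoc)
      finally show "(\<integral>\<^sup>+z. ennreal ((F z)\<^sup>2 * slab_weight S r z) * indicator A z \<partial>lborel)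
        \<le> ennreal (K * C * r powr (t - k))" .
    qed (use K C in auto)
  next
    case False
    then have \<theta>0: "\<theta> > 0" using \<theta> by simp
    \<comment> \<open>\<open>q\<close> is conjugate to \<open>1 / \<theta>\<close>. With
      \<open>\<sigma> = t - k * \<theta>\<close>, the hypothesis on \<open>s\<close> says that
      \<open>\<sigma> / \<theta> \<le> s / \<theta> - d\<close> for the dimension \<open>d\<close>,
      as the energy requires, and \<open>t < k\<close> says that \<open>\<sigma> * q < k\<close>, as
      the slab integral requires.\<close>
    define q where "q = 1 / (1 - \<theta>)"
    define \<sigma> where "\<sigma> = t - k * \<theta>"
    have q: "q > 1" using \<theta>0 \<theta> by (simp add: q_def)
    have q\<theta>: "q * (1 - \<theta>) = 1" using \<theta> by (simp add: q_def)
    have qq: "q - q * \<theta> = 1" using q\<theta> by (simp add: algebra_simps)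
    have a: "\<sigma> * q < k"
    proof -
      have "\<sigma> < k * (1 - \<theta>)" using t by (simp add: \<sigma>_def k_def algebra_simps)
      then have "\<sigma> * q < k * (1 - \<theta>) * q" using q by (intro mult_strict_right_mono) auto
      also have "k * (1 - \<theta>) * q = k * (q * (1 - \<theta>))" by simp
      finally show ?thesis using q\<theta> by simp
    qed
    define h where "h z = F z powr (2 / \<theta>) * norm z powr (s / \<theta> - real DIM('a))" for z
    have [measurable]: "h \<in> borel_measurable borel" unfolding h_def by measurable
    have h0: "h z \<ge> 0" for z by (simp add: h_def)
    have "(\<integral>\<^sup>+z. ennreal (h z) \<partial>lborel) \<noteq> \<infinity>"
      using energy False by (auto simp: fourier_energy_def ennreal_powr_def h_def F_def)
    then obtain J where J: "(\<integral>\<^sup>+z. ennreal (h z) \<partial>lborel) = ennreal J" "J \<ge> 0"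
      by (cases "\<integral>\<^sup>+z. ennreal (h z) \<partial>lborel") auto
    obtain C where C: "C \<ge> 0" "\<And>r. 0 < r \<Longrightarrow> r \<le> 1 \<Longrightarrow>
      (\<integral>\<^sup>+z. ennreal (norm z powr (- (\<sigma> * q)) * slab_weight S r z) * indicator A z \<partial>lborel)
        \<le> ennreal (C * r powr (\<sigma> * q - k))"
      using slab_integral_bound[OF S a[unfolded k_def]] unfolding A_def k_def by blast
    have pt: "(F z)\<^sup>2 * slab_weight S r z \<le> r powr (t - k) * h z
        + r powr (t - \<sigma> * q) * (norm z powr (- (\<sigma> * q)) * slab_weight S r z)"
      if "z \<in> A" "r > 0" for z r
    proof -
      let ?w = "slab_weight S r z"
      have z: "1 \<le> norm z" using that by (simp add: A_def)
      have w: "0 \<le> ?w" "?w \<le> 1" by (auto simp: slab_weight_nonneg slab_weight_le_1)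
      define l where "l = r powr (\<theta> * (t - k))" \<comment> \<open>balances the two terms of Young's inequality\<close>
      have l: "l > 0" using that by (simp add: l_def)
      \<comment> \<open>The factor \<open>a\<close> carries the transform, so that
        \<open>a powr (1 / \<theta>)\<close> is controlled by the energy integrand; \<open>b\<close>
        carries the weight, so that \<open>b powr q\<close> is controlled by the slab
        integrand.\<close>
      define a where "a = l * (F z)\<^sup>2 * norm z powr \<sigma>"
      define b where "b = ?w * norm z powr (- \<sigma>) / l"
      have a0: "a \<ge> 0" and b0: "b \<ge> 0" using l w by (auto simp: a_def b_def)
      have ab: "a * b = (F z)\<^sup>2 * ?w"
      proof -
        have "z \<noteq> 0" using z by auto
        then show ?thesis using l by (simp add: a_def b_def powr_minus field_simps)
      qed
      have "a * b \<le> a powr (1 / \<theta>) / (1 / \<theta>) + b powr q / q"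
        using \<theta>0 \<theta> q a0 b0 by (intro Youngs_inequality) (auto simp: q_def)
      also have "\<dots> \<le> a powr (1 / \<theta>) + b powr q"
      proof (rule add_mono)
        show "a powr (1 / \<theta>) / (1 / \<theta>) \<le> a powr (1 / \<theta>)"
          using \<theta> by (simp add: mult_left_le)
        show "b powr q / q \<le> b powr q" using q by (simp add: divide_le_eq mult_le_cancel_left1)
      qed
      finally have "(F z)\<^sup>2 * ?w \<le> a powr (1 / \<theta>) + b powr q" unfolding ab .
      also have "\<dots> \<le> r powr (t - k) * h z + r powr (t - \<sigma> * q) * (norm z powr (- (\<sigma> * q)) * ?w)"
      proof (rule add_mono)
        have F2: "((F z)\<^sup>2) powr (1 / \<theta>) = F z powr (2 / \<theta>)"
        proof (cases "F z = 0")
          case False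
          then have "(F z)\<^sup>2 = F z powr 2" using F0[of z] by (simp add: powr_numeral)
          then show ?thesis by (simp add: powr_powr)
        qed simp
        have "a powr (1 / \<theta>) = l powr (1 / \<theta>) * F z powr (2 / \<theta>) * (norm z powr \<sigma>) powr (1 / \<theta>)"
          using l F0 by (simp add: a_def powr_mult F2)
        also have "\<dots> = r powr (t - k) * (F z powr (2 / \<theta>) * norm z powr (\<sigma> / \<theta>))"
          using \<theta>0 by (simp add: l_def powr_powr)
        also have "\<dots> \<le> r powr (t - k) * h z"
          unfolding h_def
        proof (intro mult_left_mono powr_mono z)
          have "\<sigma> \<le> s - real DIM('a) * \<theta>" using t by (simp add: \<sigma>_def k_def algebra_simps)
          then have "\<sigma> / \<theta> \<le> (s - real DIM('a) * \<theta>) / \<theta>" using \<theta>0 by (intro divide_right_mono) auto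
          then show "\<sigma> / \<theta> \<le> s / \<theta> - real DIM('a)" using \<theta>0 by (simp add: diff_divide_distrib)
        qed auto
        finally show "a powr (1 / \<theta>) \<le> r powr (t - k) * h z" .
        \<comment> \<open>This power of \<open>r\<close> times the slab bound
          \<open>r powr (\<sigma> * q - k)\<close> is \<open>r powr (t - k)\<close>, the order of
          the energy term.\<close>
        have lq: "l powr (- q) = r powr (t - \<sigma> * q)"
        proof -
          have "\<theta> * (t - k) * (- q) = t * (q - q * \<theta>) - (t - k * \<theta>) * q" by (simp add: algebra_simps)
          then show ?thesis unfolding l_def powr_powr by (simp add: qq \<sigma>_def)
        qed
        have "b powr q = ?w powr q * norm z powr (- (\<sigma> * q)) * l powr (- q)"
          using w l by (simp add: b_def powr_mult powr_divide powr_powr powr_minus[of l] divide_inverse inverse_powr)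
        also have "\<dots> \<le> ?w * norm z powr (- (\<sigma> * q)) * l powr (- q)"
        proof (intro mult_right_mono)
          \<comment> \<open>The weight lies in \<open>[0, 1]\<close> and \<open>q > 1\<close>, so
            the slab bound for the first power of the weight suffices.\<close>
          show "?w powr q \<le> ?w"
          proof (cases "?w = 0")
            case False
            then show ?thesis using w q powr_mono'[of 1 q ?w] by simp
          qed simp
        qed auto
        finally show "b powr q \<le> r powr (t - \<sigma> * q) * (norm z powr (- (\<sigma> * q)) * ?w)"
          by (simp add: lq mult_ac)
      qed
      finally show ?thesis .
    qed
    show ?thesis
    proof (intro exI[of _ "J + C"] conjI allI impI)
      fix r :: real assume r: "0 < r \<and> r \<le> 1"
      have "(\<integral>\<^sup>+z. ennreal ((F z)\<^sup>2 * slab_weight S r z) * indicator A z \<partial>lborel)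
        \<le> (\<integral>\<^sup>+z. ennreal (r powr (t - k)) * ennreal (h z) + ennreal (r powr (t - \<sigma> * q)) *
             (ennreal (norm z powr (- (\<sigma> * q)) * slab_weight S r z) * indicator A z) \<partial>lborel)"
      proof (intro nn_integral_mono)
        fix z :: 'a
        show "ennreal ((F z)\<^sup>2 * slab_weight S r z) * indicator A z
          \<le> ennreal (r powr (t - k)) * ennreal (h z) + ennreal (r powr (t - \<sigma> * q)) *
             (ennreal (norm z powr (- (\<sigma> * q)) * slab_weight S r z) * indicator A z)"
          using pt[of z r] r h0[of z] slab_weight_nonneg[of S r z]
          by (cases "z \<in> A") (auto simp: ennreal_mult'[symmetric] ennreal_plus[symmetric] simp del: ennreal_plus intro!: ennreal_leI)
      qed
      also have "\<dots> = ennreal (r powr (t - k)) * (\<integral>\<^sup>+z. ennreal (h z) \<partial>lborel) + ennreal (r powr (t - \<sigma> * q)) *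
             (\<integral>\<^sup>+z. ennreal (norm z powr (- (\<sigma> * q)) * slab_weight S r z) * indicator A z \<partial>lborel)"
        by (simp add: nn_integral_add nn_integral_cmult)
      also have "\<dots> \<le> ennreal (r powr (t - k)) * ennreal J + ennreal (r powr (t - \<sigma> * q)) * ennreal (C * r powr (\<sigma> * q - k))"
        using C(2)[of r] r J by (intro add_mono mult_left_mono) auto
      also have "\<dots> = ennreal (r powr (t - k) * J + r powr (t - \<sigma> * q) * (C * r powr (\<sigma> * q - k)))"
        using J C by (simp add: ennreal_mult'[symmetric] ennreal_plus[symmetric] del: ennreal_plus)
      also have "r powr (t - k) * J + r powr (t - \<sigma> * q) * (C * r powr (\<sigma> * q - k)) = (J + C) * r powr (t - k)"
        using r by (simp add: powr_diff field_simps)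
      finally show "(\<integral>\<^sup>+z. ennreal ((F z)\<^sup>2 * slab_weight S r z) * indicator A z \<partial>lborel)
        \<le> ennreal ((J + C) * r powr (t - k))" .
    qed (use J C in auto)
  qed
  then obtain C where C: "C \<ge> 0" "\<And>r. 0 < r \<Longrightarrow> r \<le> 1 \<Longrightarrow>
    (\<integral>\<^sup>+z. ennreal ((F z)\<^sup>2 * slab_weight S r z) * indicator A z \<partial>lborel) \<le> ennreal (C * r powr (t - k))"
    by blast
  show thesis
  proof (rule that[of "M\<^sup>2 * V + C"])
    have V0: "V \<ge> 0" by (simp add: V_def)
    show "0 \<le> M\<^sup>2 * V + C" using V0 C by simp
    fix r :: real assume r: "0 < r" "r \<le> 1"
    have le: "ennreal ((F z)\<^sup>2 * slab_weight S r z)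
        \<le> ennreal (M\<^sup>2) * indicator (ball 0 1) z + ennreal ((F z)\<^sup>2 * slab_weight S r z) * indicator A z" for z
    proof (cases "z \<in> A")
      case False
      have "(F z)\<^sup>2 * slab_weight S r z \<le> M\<^sup>2 * 1"
        using F0 FM slab_weight_le_1 slab_weight_nonneg by (intro mult_mono power_mono) auto
      then show ?thesis using False by (auto simp: A_def intro!: ennreal_leI)
    qed (simp add: add_increasing)
    \<comment> \<open>Since \<open>t < k\<close> and \<open>r \<le> 1\<close>, the constant from the
      unit ball is absorbed into the main term.\<close>
    have rp: "1 \<le> r powr (t - k)" using r t powr_mono'[of "t - k" 0 r] by (simp add: k_def)
    have "(\<integral>\<^sup>+z. ennreal ((F z)\<^sup>2 * slab_weight S r z) \<partial>lborel)
      \<le> (\<integral>\<^sup>+z. ennreal (M\<^sup>2) * indicator (ball 0 1) z + ennreal ((F z)\<^sup>2 * slab_weight S r z) * indicator A z \<partial>lborel)"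
      by (intro nn_integral_mono le)
    also have "\<dots> = ennreal (M\<^sup>2) * ennreal V + (\<integral>\<^sup>+z. ennreal ((F z)\<^sup>2 * slab_weight S r z) * indicator A z \<partial>lborel)"
    proof -
      have [measurable]: "ball (0::'a) 1 \<in> sets borel" by simp
      show ?thesis by (simp add: nn_integral_add nn_integral_cmult_indicator V)
    qed
    also have "\<dots> \<le> ennreal (M\<^sup>2) * ennreal V + ennreal (C * r powr (t - k))"
      using C(2)[OF r] by (rule add_left_mono)
    also have "\<dots> = ennreal (M\<^sup>2 * V * 1 + C * r powr (t - k))"
      using V0 C by (simp add: ennreal_mult'[symmetric] ennreal_plus[symmetric] del: ennreal_plus)
    also have "\<dots> \<le> ennreal (M\<^sup>2 * V * r powr (t - k) + C * r powr (t - k))"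
      using rp V0 by (intro ennreal_leI add_right_mono mult_left_mono) auto
    finally show "(\<integral>\<^sup>+z. ennreal ((norm (fourier_transform \<mu> z))\<^sup>2 * slab_weight S r z) \<partial>lborel)
      \<le> ennreal ((M\<^sup>2 * V + C) * r powr (t - real (card S)))"
      by (simp add: F_def k_def distrib_right)
  qed
qed

section \<open>Correlation of the projected measure\<close>

definition coord_proj :: "'a::euclidean_space set \<Rightarrow> 'a \<Rightarrow> 'a" where
  "coord_proj S x = (\<Sum>b\<in>S. (x \<bullet> b) *\<^sub>R b)"

lemma coord_proj_measurable[measurable]: "coord_proj S \<in> borel_measurable borel"
  unfolding coord_proj_def by measurable

lemma norm_coord_proj:
  assumes "S \<subseteq> (Basis :: 'a::euclidean_space set)"
  shows "(norm (coord_proj S x))\<^sup>2 = (\<Sum>b\<in>S. (x \<bullet> b)\<^sup>2)"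
proof -
  have "finite S" using assms finite_subset finite_Basis by blast
  then have "coord_proj S x \<bullet> b = x \<bullet> b" if "b \<in> S" for b
    using that assms by (simp add: coord_proj_def inner_sum_left inner_Basis subset_iff if_distrib cong: if_cong)
  then have "coord_proj S x \<bullet> coord_proj S x = (\<Sum>b\<in>S. (x \<bullet> b) * (x \<bullet> b))"
    by (subst (2) coord_proj_def) (simp add: inner_sum_right)
  then show ?thesis unfolding power2_norm_eq_inner by (simp add: power2_eq_square)
qed

text \<open>Almost every counted pair has \<open>norm (x - y) \<le> 2 * R\<close> and projections
  within \<open>r\<close>, hence the Gaussian kernel there is at least a constant times
  \<open>r powr (- k)\<close>. The energy identity and the weighted bound give
  \<open>r powr (t - k)\<close> for the integral of the kernel, and the factor
  \<open>r powr k\<close> leaves \<open>r powr t\<close>.\<close>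

lemma correlation_bound:
  fixes \<mu> :: "'a::euclidean_space measure" and S :: "'a set"
  assumes fin: "finite_measure \<mu>" and sets[measurable_cong]: "sets \<mu> = sets borel"
    and bdd: "AE x in \<mu>. norm x \<le> R"
    and S: "S \<subseteq> Basis" and \<theta>: "0 \<le> \<theta>" "\<theta> < 1"
    and t: "t < real (card S)" "t + (real DIM('a) - real (card S)) * \<theta> \<le> s"
    and energy: "fourier_energy s \<theta> \<mu> < \<infinity>"
  obtains C where "\<And>r. 0 < r \<Longrightarrow> r \<le> 1 \<Longrightarrow>
    (\<integral>\<^sup>+x. emeasure \<mu> {y\<in>space \<mu>. dist (coord_proj S x) (coord_proj S y) \<le> r} \<partial>\<mu>) \<le> ennreal (C * r powr t)"
proof -
  interpret finite_measure \<mu> by fact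
  obtain C where C: "C \<ge> 0" "\<And>r. 0 < r \<Longrightarrow> r \<le> 1 \<Longrightarrow>
    (\<integral>\<^sup>+z. ennreal ((norm (fourier_transform \<mu> z))\<^sup>2 * slab_weight S r z) \<partial>lborel)
      \<le> ennreal (C * r powr (t - real (card S)))"
    using weighted_energy_bound[OF fin sets S \<theta> t energy] by blast
  have finS: "finite S" using S finite_subset finite_Basis by blast
  \<comment> \<open>\<open>D\<close> undoes the smallest value of the Gaussian factor on the counted
    pairs: the coordinates in \<open>S\<close> contribute at most 1 to the exponent, the others at
    most \<open>(2 * R)\<^sup>2\<close>, up to the factor \<open>pi\<close>.\<close>
  define D where "D = exp (pi * (1 + (2 * R)\<^sup>2))"
  show thesis
  proof (rule that[of "D * C"])
    fix r :: real assume r: "0 < r" "r \<le> 1"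
    define c where "c b = (if b \<in> S then r else 1)" for b :: 'a
    have c: "c b > 0" for b using r by (simp add: c_def)
    define G where "G v = (\<Prod>b\<in>Basis. 1 / c b * exp (- pi * (v \<bullet> b)\<^sup>2 / (c b)\<^sup>2))" for v :: 'a
    have G0: "G v \<ge> 0" for v unfolding G_def using c by (intro prod_nonneg mult_nonneg_nonneg) (auto simp: less_imp_le)
    have [measurable]: "G \<in> borel_measurable borel" unfolding G_def by measurable
    have pt: "1 \<le> D * r ^ card S * G (x - y)"
      if x: "norm x \<le> R" and y: "norm y \<le> R" and d: "dist (coord_proj S x) (coord_proj S y) \<le> r" for x y
    proof -
      define v where "v = x - y"
      have "norm v \<le> 2 * R" unfolding v_def using norm_triangle_ineq4[of x y] x y by linarith
      then have v2: "(norm v)\<^sup>2 \<le> (2 * R)\<^sup>2" by (intro power_mono) auto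
      have "coord_proj S x - coord_proj S y = coord_proj S v"
        by (simp add: coord_proj_def v_def inner_diff_left scaleR_diff_left sum_subtractf)
      then have "(norm (coord_proj S v))\<^sup>2 \<le> r\<^sup>2" using d r by (intro power_mono) (auto simp: dist_norm)
      then have s1: "(\<Sum>b\<in>S. (v \<bullet> b)\<^sup>2 / r\<^sup>2) \<le> 1"
        using r by (simp add: norm_coord_proj[OF S] sum_divide_distrib[symmetric])
      have "(\<Sum>b\<in>Basis - S. (v \<bullet> b)\<^sup>2) \<le> (\<Sum>b\<in>Basis. (v \<bullet> b)\<^sup>2)"
        by (intro sum_mono2) auto
      also have "\<dots> = (norm v)\<^sup>2"
        unfolding power2_norm_eq_inner by (subst euclidean_inner) (simp add: power2_eq_square)
      finally have s2: "(\<Sum>b\<in>Basis - S. (v \<bullet> b)\<^sup>2) \<le> (2 * R)\<^sup>2" using v2 by simp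
      have "(\<Sum>b\<in>Basis. (v \<bullet> b)\<^sup>2 / (c b)\<^sup>2) = (\<Sum>b\<in>S. (v \<bullet> b)\<^sup>2 / r\<^sup>2) + (\<Sum>b\<in>Basis - S. (v \<bullet> b)\<^sup>2)"
        using S by (subst sum.subset_diff[OF S]) (simp_all add: c_def)
      then have s3: "(\<Sum>b\<in>Basis. (v \<bullet> b)\<^sup>2 / (c b)\<^sup>2) \<le> 1 + (2 * R)\<^sup>2" using s1 s2 by linarith
      have "(\<Prod>b\<in>Basis. 1 / c b) = (\<Prod>b\<in>S. 1 / r)"
        unfolding prod_Basis_if[OF S, symmetric] c_def by (intro prod.cong) auto
      then have "G v = (1 / r ^ card S) * exp (- pi * (\<Sum>b\<in>Basis. (v \<bullet> b)\<^sup>2 / (c b)\<^sup>2))"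
        unfolding G_def prod.distrib by (simp add: exp_sum[symmetric] sum_distrib_left sum_negf power_divide)
      then have "D * r ^ card S * G v = exp (pi * (1 + (2 * R)\<^sup>2) - pi * (\<Sum>b\<in>Basis. (v \<bullet> b)\<^sup>2 / (c b)\<^sup>2))"
        using r by (simp add: D_def exp_diff exp_minus field_simps)
      moreover have "0 \<le> pi * (1 + (2 * R)\<^sup>2) - pi * (\<Sum>b\<in>Basis. (v \<bullet> b)\<^sup>2 / (c b)\<^sup>2)"
        using s3 by (simp add: mult_left_mono)
      ultimately show ?thesis by (simp add: v_def)
    qed
    have "(\<integral>\<^sup>+x. emeasure \<mu> {y\<in>space \<mu>. dist (coord_proj S x) (coord_proj S y) \<le> r} \<partial>\<mu>)
      = (\<integral>\<^sup>+x. \<integral>\<^sup>+y. indicator {y\<in>space \<mu>. dist (coord_proj S x) (coord_proj S y) \<le> r} y \<partial>\<mu> \<partial>\<mu>)"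
      by (intro nn_integral_cong) (simp add: nn_integral_indicator)
    also have "\<dots> \<le> (\<integral>\<^sup>+x. \<integral>\<^sup>+y. ennreal (D * r ^ card S) * ennreal (G (x - y)) \<partial>\<mu> \<partial>\<mu>)"
    proof (rule nn_integral_mono_AE)
      show "AE x in \<mu>. (\<integral>\<^sup>+y. indicator {y\<in>space \<mu>. dist (coord_proj S x) (coord_proj S y) \<le> r} y \<partial>\<mu>)
         \<le> (\<integral>\<^sup>+y. ennreal (D * r ^ card S) * ennreal (G (x - y)) \<partial>\<mu>)"
        using bdd
      proof eventually_elim
        case x: (elim x)
        show ?case
        proof (rule nn_integral_mono_AE)
          show "AE y in \<mu>. indicator {y\<in>space \<mu>. dist (coord_proj S x) (coord_proj S y) \<le> r} y
            \<le> ennreal (D * r ^ card S) * ennreal (G (x - y))"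
            using bdd
          proof eventually_elim
            case (elim y)
            then show ?case using pt[OF x elim] r G0
              by (auto simp: indicator_def ennreal_mult[symmetric] D_def simp flip: ennreal_1 intro!: ennreal_leI)
          qed
        qed
      qed
    qed
    also have "\<dots> = ennreal (D * r ^ card S) * (\<integral>\<^sup>+x. \<integral>\<^sup>+y. ennreal (G (x - y)) \<partial>\<mu> \<partial>\<mu>)"
      by (simp add: nn_integral_cmult)
    also have "\<dots> = ennreal (D * r ^ card S) *
        (\<integral>\<^sup>+z. ennreal ((norm (fourier_transform \<mu> z))\<^sup>2 * slab_weight S r z) \<partial>lborel)"
      using nn_integral_gaussian_energy[OF fin sets, of c] c by (simp add: G_def slab_weight_def c_def)
    also have "\<dots> \<le> ennreal (D * r ^ card S) * ennreal (C * r powr (t - real (card S)))"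
      using C(2)[OF r] by (intro mult_left_mono) auto
    also have "\<dots> = ennreal (D * C * r powr t)"
      using r C by (simp add: ennreal_mult[symmetric] D_def powr_diff powr_realpow)
    finally show "(\<integral>\<^sup>+x. emeasure \<mu> {y\<in>space \<mu>. dist (coord_proj S x) (coord_proj S y) \<le> r} \<partial>\<mu>)
      \<le> ennreal (D * C * r powr t)" .
  qed
qed

subsection \<open>From correlation to Hausdorff measure\<close>

lemma summable_powr_neg:
  fixes x :: real
  assumes "x > 0"
  shows "summable (\<lambda>n. ((1/2::real) ^ n) powr x)"
proof -
  have "((1/2::real) ^ n) powr x = ((1/2) powr x) ^ n" for n
    by (simp add: powr_realpow[symmetric] powr_powr mult.commute)
  moreover have "(1/2::real) powr x < 1" using assms powr_less_mono'[of "1/2" 0 x] by simp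
  ultimately show ?thesis by (simp add: summable_geometric)
qed

text \<open>The Frostman-type argument: since the dyadic \<open>t\<close>-potential of \<open>\<mu>\<close> along \<open>g\<close> has finite integral,
  it is bounded on a set of positive measure, to which the mass distribution principle applies.\<close>

lemma hausdorff_measure_pos_of_correlation:
  fixes \<mu> :: "'a measure" and g :: "'a \<Rightarrow> 'b::euclidean_space"
  assumes fin: "finite_measure \<mu>" and [measurable]: "g \<in> borel_measurable \<mu>"
    and pos: "emeasure \<mu> (space \<mu>) > 0" and X: "AE x in \<mu>. x \<in> X"
    and t: "0 \<le> t" "t < t'"
    and corr: "\<And>r. 0 < r \<Longrightarrow> r \<le> 1 \<Longrightarrow>
      (\<integral>\<^sup>+x. emeasure \<mu> {y\<in>space \<mu>. dist (g x) (g y) \<le> r} \<partial>\<mu>) \<le> ennreal (C * r powr t')"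
  shows "hausdorff_measure t (g ` X) > 0"
proof -
  interpret finite_measure \<mu> by fact
  define N where "N r x = emeasure \<mu> {y\<in>space \<mu>. dist (g x) (g y) \<le> r}" for r x
  define \<delta> where "\<delta> n = (1/2::real) ^ n" for n
  have \<delta>: "\<delta> n > 0" "\<delta> n \<le> 1" for n by (auto simp: \<delta>_def power_le_one)
  have [measurable]: "N r \<in> borel_measurable \<mu>" for r
    unfolding N_def by measurable
  \<comment> \<open>A sum over dyadic scales replaces the kernel
    \<open>dist (g x) (g y) powr (- t)\<close>. By the correlation bound its integral is at most a
    geometric series of ratio \<open>(1/2) powr (t' - t) < 1\<close>.\<close>
  define \<phi> where "\<phi> x = (\<Sum>n. ennreal (\<delta> n powr (- t)) * N (\<delta> n) x)" for x
  have [measurable]: "\<phi> \<in> borel_measurable \<mu>" unfolding \<phi>_def by measurable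
  have "(\<integral>\<^sup>+x. \<phi> x \<partial>\<mu>) = (\<Sum>n. ennreal (\<delta> n powr (- t)) * (\<integral>\<^sup>+x. N (\<delta> n) x \<partial>\<mu>))"
    unfolding \<phi>_def by (simp add: nn_integral_suminf nn_integral_cmult)
  also have "\<dots> \<le> (\<Sum>n. ennreal (\<bar>C\<bar> * \<delta> n powr (t' - t)))"
  proof (intro suminf_le summableI)
    fix n
    have "ennreal (\<delta> n powr (- t)) * (\<integral>\<^sup>+x. N (\<delta> n) x \<partial>\<mu>) \<le> ennreal (\<delta> n powr (- t)) * ennreal (\<bar>C\<bar> * \<delta> n powr t')"
      using corr[OF \<delta>, of n] unfolding N_def
      by (intro mult_left_mono) (auto elim!: order_trans intro!: ennreal_leI mult_right_mono)
    also have "\<dots> = ennreal (\<bar>C\<bar> * \<delta> n powr (t' - t))"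
      by (simp add: ennreal_mult[symmetric] powr_diff powr_minus field_simps)
    finally show "ennreal (\<delta> n powr (- t)) * (\<integral>\<^sup>+x. N (\<delta> n) x \<partial>\<mu>) \<le> ennreal (\<bar>C\<bar> * \<delta> n powr (t' - t))" .
  qed
  also have "\<dots> < \<infinity>"
  proof -
    have "summable (\<lambda>n. \<bar>C\<bar> * \<delta> n powr (t' - t))"
      unfolding \<delta>_def using t by (intro summable_mult summable_powr_neg) auto
    then show ?thesis by (subst suminf_ennreal2) auto
  qed
  finally have "AE x in \<mu>. \<phi> x \<noteq> \<infinity>"
    by (intro nn_integral_PInf_AE) auto
  \<comment> \<open>As \<open>\<phi>\<close> is finite almost everywhere, the sublevel sets exhaust
    almost all of the space, so one of them has positive measure.\<close>
  define A where "A M = {x\<in>space \<mu>. \<phi> x \<le> of_nat M}" for M :: nat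
  have Am[measurable]: "A M \<in> sets \<mu>" for M unfolding A_def by measurable
  have "\<exists>M. emeasure \<mu> (A M) > 0"
  proof (rule ccontr)
    assume "\<nexists>M. emeasure \<mu> (A M) > 0"
    then have "AE x in \<mu>. x \<notin> A M" for M
      by (intro AE_not_in) (auto simp: null_sets_def)
    then have "AE x in \<mu>. \<forall>M. x \<notin> A M" by (simp add: AE_all_countable)
    with \<open>AE x in \<mu>. \<phi> x \<noteq> \<infinity>\<close> AE_space have "AE x in \<mu>. False"
    proof eventually_elim
      case (elim x)
      then obtain M where "\<phi> x \<le> of_nat M"
        using ennreal_Ex_less_of_nat[of "\<phi> x"] by (auto simp: less_top intro: less_imp_le)
      with elim show False by (auto simp: A_def)
    qed
    then have "emeasure \<mu> (space \<mu>) = 0"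
      using AE_iff_measurable[of "space \<mu>" \<mu> "\<lambda>_. False"] by simp
    then show False using pos by simp
  qed
  then obtain M where M: "emeasure \<mu> (A M) > 0" by blast
  \<comment> \<open>The single term of \<open>\<phi>\<close> at the dyadic scale just above
    \<open>d\<close> suffices; that scale is below \<open>2 * d\<close>, whence
    \<open>2 powr t\<close>. The summand 1 keeps the constant positive even for
    \<open>M = 0\<close>.\<close>
  have ball: "emeasure \<mu> {y\<in>space \<mu>. dist (g x) (g y) \<le> d} \<le> ennreal ((real M + 1) * 2 powr t) * ennreal (d powr t)"
    if x: "x \<in> A M" and d: "0 < d" "d \<le> 1" for x d
  proof -
    \<comment> \<open>The least \<open>m\<close> with \<open>\<delta> m < d\<close> is not 0,
      because \<open>d \<le> 1 = \<delta> 0\<close>; its predecessor is the required index.\<close>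
    obtain n where n: "\<delta> (Suc n) < d" "d \<le> \<delta> n"
    proof -
      have "\<exists>m. \<delta> m < d" using d real_arch_pow_inv[of d "1/2"] by (auto simp: \<delta>_def)
      then have L: "\<delta> (LEAST m. \<delta> m < d) < d" by (rule LeastI_ex)
      have "(LEAST m. \<delta> m < d) \<noteq> 0" using L d by (metis \<delta>_def not_le power_0)
      then obtain n where n: "(LEAST m. \<delta> m < d) = Suc n" using not0_implies_Suc by blast
      then have "\<not> \<delta> n < d" by (metis lessI not_less_Least)
      with n L show thesis by (intro that[of n]) auto
    qed
    have "ennreal (\<delta> n powr (- t)) * N (\<delta> n) x \<le> \<phi> x"
      unfolding \<phi>_def using sum_le_suminf[of "\<lambda>n. ennreal (\<delta> n powr (- t)) * N (\<delta> n) x" "{n}"] by simp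
    also have "\<dots> \<le> ennreal (real M)" using x by (simp add: A_def ennreal_of_nat_eq_real_of_nat)
    finally have le: "ennreal (\<delta> n powr (- t)) * N (\<delta> n) x \<le> ennreal (real M)" .
    have "N (\<delta> n) x = ennreal (\<delta> n powr t) * (ennreal (\<delta> n powr (- t)) * N (\<delta> n) x)"
      using \<delta>[of n] by (simp add: mult.assoc[symmetric] ennreal_mult[symmetric] powr_minus)
    also have "\<dots> \<le> ennreal (\<delta> n powr t) * ennreal (real M)"
      using le by (intro mult_left_mono) auto
    also have "\<dots> \<le> ennreal ((2 * d) powr t) * ennreal (real M + 1)"
      using n t \<delta>[of n] by (intro mult_mono ennreal_leI powr_mono2) (auto simp: \<delta>_def)
    also have "\<dots> = ennreal ((real M + 1) * 2 powr t) * ennreal (d powr t)"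
      using d by (simp add: ennreal_mult[symmetric] powr_mult field_simps)
    finally have "N (\<delta> n) x \<le> ennreal ((real M + 1) * 2 powr t) * ennreal (d powr t)" .
    moreover have "emeasure \<mu> {y\<in>space \<mu>. dist (g x) (g y) \<le> d} \<le> N (\<delta> n) x"
      unfolding N_def using n by (intro emeasure_mono) auto
    ultimately show ?thesis by (rule order_trans[rotated])
  qed
  \<comment> \<open>The total mass enters for \<open>t = 0\<close>, where \<open>diam_powr\<close>
    counts every nonempty set as 1.\<close>
  define K where "K = max ((real M + 1) * 2 powr t) (measure \<mu> (space \<mu>))"
  \<comment> \<open>A covering set that contains \<open>g x\<close> lies in the closed ball about
    \<open>g x\<close> whose radius is its diameter, so it suffices to measure such balls.\<close>
  have cover: "emeasure \<mu> {y\<in>space \<mu>. dist (g x) (g y) \<le> diameter U} \<le> ennreal K * diam_powr t U"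
    if x: "x \<in> A M" "g x \<in> U" and U: "diameter U \<le> 1" "bounded U" for x U
  proof -
    have d0: "diameter U \<ge> 0" using U(2) by (rule diameter_ge_0)
    have ne: "U \<noteq> {}" using x by auto
    show ?thesis
    proof (cases "t = 0")
      case True
      have "emeasure \<mu> {y\<in>space \<mu>. dist (g x) (g y) \<le> diameter U} \<le> emeasure \<mu> (space \<mu>)"
        by (intro emeasure_mono) auto
      also have "\<dots> \<le> ennreal K" unfolding emeasure_eq_measure K_def by (intro ennreal_leI) auto
      finally show ?thesis using True ne by (simp add: diam_powr_def)
    next
      case False
      let ?e = "diameter U"
      have lim: "emeasure \<mu> {y\<in>space \<mu>. dist (g x) (g y) \<le> ?e} \<le> ennreal K * ennreal (d powr t)"
        if "?e \<le> d" "0 < d" "d \<le> 1" for d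
      proof -
        have "emeasure \<mu> {y\<in>space \<mu>. dist (g x) (g y) \<le> ?e} \<le> emeasure \<mu> {y\<in>space \<mu>. dist (g x) (g y) \<le> d}"
          using that by (intro emeasure_mono) auto
        also have "\<dots> \<le> ennreal ((real M + 1) * 2 powr t) * ennreal (d powr t)"
          using ball[OF x(1)] that by auto
        also have "\<dots> \<le> ennreal K * ennreal (d powr t)"
          unfolding K_def by (intro mult_right_mono ennreal_leI) auto
        finally show ?thesis .
      qed
      show ?thesis
      proof (cases "?e = 0")
        case True
        have K0: "K \<ge> 0" unfolding K_def by (simp add: le_max_iff_disj)
        \<comment> \<open>A set of diameter 0 offers no positive radius for the ball estimate;
          letting the radius tend to 0 shows that the fibre over a point is null when
          \<open>t > 0\<close>.\<close>
        have "((\<lambda>n. ennreal (K * \<delta> n powr t)) \<longlongrightarrow> ennreal (K * 0 powr t)) sequentially"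
          unfolding \<delta>_def using t False
          by (intro tendsto_ennrealI tendsto_mult tendsto_const tendsto_powr' LIMSEQ_power_zero) auto
        then have "((\<lambda>n. ennreal (K * \<delta> n powr t)) \<longlonglongrightarrow> 0)" by simp
        then have "emeasure \<mu> {y\<in>space \<mu>. dist (g x) (g y) \<le> ?e} \<le> 0"
          using lim[OF _ \<delta>] True \<delta> K0
          by (intro LIMSEQ_le_const[where X = "\<lambda>n. ennreal (K * \<delta> n powr t)"])
             (auto simp: ennreal_mult less_imp_le)
        then show ?thesis by simp
      next
        case False
        then show ?thesis using lim[of ?e] d0 U ne \<open>t \<noteq> 0\<close> by (simp add: diam_powr_def)
      qed
    qed
  qed
  have "emeasure \<mu> (A M) \<le> ennreal K * hausdorff_pre_measure t 1 (g ` X)"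
  proof -
    have K0: "K > 0" unfolding K_def by (simp add: less_max_iff_disj add_nonneg_pos)
    have "ennreal (1 / K) * emeasure \<mu> (A M) \<le> hausdorff_pre_measure t 1 (g ` X)"
      unfolding hausdorff_pre_measure_def
    proof (rule Inf_greatest, clarify)
      fix U :: "nat \<Rightarrow> 'b set"
      assume U: "g ` X \<subseteq> (\<Union>i. U i)" "\<forall>i. bounded (U i) \<and> diameter (U i) \<le> 1"
      define I where "I = {i. \<exists>x\<in>A M. g x \<in> U i}"
      define c where "c i = (SOME x. x \<in> A M \<and> g x \<in> U i)" for i
      have c: "c i \<in> A M" "g (c i) \<in> U i" if "i \<in> I" for i
        using that someI_ex[of "\<lambda>x. x \<in> A M \<and> g x \<in> U i"] by (auto simp: I_def c_def)
      define B where "B i = (if i \<in> I then {y\<in>space \<mu>. dist (g (c i)) (g y) \<le> diameter (U i)} else {})" for i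
      have Bm: "range B \<subseteq> sets \<mu>" unfolding B_def by auto
      have "AE x in \<mu>. x \<in> A M \<longrightarrow> x \<in> (\<Union>i. B i)"
        using X AE_space
      proof eventually_elim
        case (elim x)
        show ?case
        proof
          assume xA: "x \<in> A M"
          from elim U obtain i where i: "g x \<in> U i" by auto
          with xA have "i \<in> I" by (auto simp: I_def)
          moreover have "dist (g (c i)) (g x) \<le> diameter (U i)"
            using U c[OF \<open>i \<in> I\<close>] i by (intro diameter_bounded_bound) auto
          ultimately show "x \<in> (\<Union>i. B i)" using elim by (auto simp: B_def)
        qed
      qed
      then have "emeasure \<mu> (A M) \<le> emeasure \<mu> (\<Union>i. B i)"
        using Bm by (intro emeasure_mono_AE) auto
      also have "\<dots> \<le> (\<Sum>i. emeasure \<mu> (B i))"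
        using Bm by (rule emeasure_subadditive_countably)
      also have "\<dots> \<le> (\<Sum>i. ennreal K * diam_powr t (U i))"
        using cover c U by (intro suminf_le summableI) (auto simp: B_def)
      also have "\<dots> = ennreal K * (\<Sum>i. diam_powr t (U i))" by simp
      finally have "ennreal (1 / K) * emeasure \<mu> (A M) \<le> ennreal (1 / K) * (ennreal K * (\<Sum>i. diam_powr t (U i)))"
        by (intro mult_left_mono) auto
      also have "\<dots> = (\<Sum>i. diam_powr t (U i))"
        using K0 by (simp add: mult.assoc[symmetric] ennreal_mult[symmetric])
      finally show "ennreal (1 / K) * emeasure \<mu> (A M) \<le> (\<Sum>i. diam_powr t (U i))" .
    qed
    then have "ennreal K * (ennreal (1 / K) * emeasure \<mu> (A M)) \<le> ennreal K * hausdorff_pre_measure t 1 (g ` X)"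
      by (intro mult_left_mono) auto
    then show ?thesis using K0 by (simp add: mult.assoc[symmetric] ennreal_mult[symmetric])
  qed
  also have "\<dots> \<le> ennreal K * hausdorff_measure t (g ` X)"
    unfolding hausdorff_measure_def by (intro mult_left_mono SUP_upper) auto
  finally have "0 < ennreal K * hausdorff_measure t (g ` X)" using M by simp
  then show ?thesis using ennreal_zero_less_mult_iff by blast
qed

subsection \<open>Supported measures and projections\<close>

text \<open>By the Lindelof property the union of all open null sets is a countable union of such
  sets, hence null.\<close>

lemma AE_measure_support:
  fixes \<mu> :: "'a::euclidean_space measure"
  assumes sets: "sets \<mu> = sets borel"
  shows "AE x in \<mu>. x \<in> measure_support \<mu>"
proof -
  let ?F = "{U. open U \<and> emeasure \<mu> U = 0}"
  obtain F where F: "F \<subseteq> ?F" "countable F" "\<Union>F = \<Union>?F"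
    using Lindelof[of ?F] by blast
  have "\<Union>F \<in> null_sets \<mu>"
    using F sets by (intro null_sets_UN'[of F "\<lambda>x. x", simplified]) (auto simp: null_sets_def)
  then have "AE x in \<mu>. x \<notin> \<Union>F" by (rule AE_not_in)
  then show ?thesis unfolding measure_support_def F(3) by eventually_elim auto
qed

text \<open>The complement of \<open>X\<close> is null because it misses the support. The whole mass
  is therefore \<open>emeasure \<mu> X\<close>, which gives finiteness and positivity; compactness
  of the support gives the bound \<open>R\<close>.\<close>

lemma supported_measuresD:
  fixes \<mu> :: "'a::euclidean_space measure"
  assumes \<mu>: "\<mu> \<in> supported_measures X" and X: "X \<in> sets borel"
  shows "finite_measure \<mu>" "sets \<mu> = sets borel" "AE x in \<mu>. x \<in> X"
    "\<exists>R. AE x in \<mu>. norm x \<le> R" "emeasure \<mu> (space \<mu>) > 0"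
proof -
  show sets: "sets \<mu> = sets borel" using \<mu> by (simp add: supported_measures_def)
  note AE = AE_measure_support[OF sets]
  have sub: "measure_support \<mu> \<subseteq> X" and comp: "compact (measure_support \<mu>)"
    using \<mu> by (auto simp: supported_measures_def)
  show X': "AE x in \<mu>. x \<in> X" using AE by eventually_elim (use sub in auto)
  obtain R where R: "\<And>x. x \<in> measure_support \<mu> \<Longrightarrow> norm x \<le> R"
    using compact_imp_bounded[OF comp] by (auto simp: bounded_iff)
  have "AE x in \<mu>. norm x \<le> R" using AE by eventually_elim (rule R)
  then show "\<exists>R. AE x in \<mu>. norm x \<le> R" by blast
  have eq: "emeasure \<mu> (space \<mu>) = emeasure \<mu> X"
    using X' X sets by (intro emeasure_eq_AE) (auto simp: sets_eq_imp_space_eq[OF sets])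
  show "finite_measure \<mu>"
    by (rule finite_measureI) (use \<mu> eq in \<open>auto simp: supported_measures_def\<close>)
  show "emeasure \<mu> (space \<mu>) > 0" using \<mu> eq by (auto simp: supported_measures_def)
qed

section \<open>Rotation of measures and subspaces\<close>

lemma orthogonal_transformation_measurable:
  fixes g :: "'a::euclidean_space \<Rightarrow> 'a"
  assumes "orthogonal_transformation g"
  shows "g \<in> borel_measurable borel"
  using orthogonal_transformation_linear[OF assms]
  by (intro borel_measurable_continuous_onI linear_continuous_on) (simp add: linear_conv_bounded_linear)

text \<open>The transform of the image measure at \<open>z\<close> is that of \<open>\<mu>\<close>
  at \<open>inv g z\<close>. The norm, Lebesgue measure and the range of the supremum are all
  invariant under \<open>inv g\<close>.\<close>

lemma fourier_energy_distr_orthogonal: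
  fixes \<mu> :: "'a::euclidean_space measure" and g :: "'a \<Rightarrow> 'a"
  assumes g: "orthogonal_transformation g" and fin: "finite_measure \<mu>"
    and sets[measurable_cong]: "sets \<mu> = sets borel"
  shows "fourier_energy s \<theta> (distr \<mu> borel g) = fourier_energy s \<theta> \<mu>"
proof -
  note [measurable] = orthogonal_transformation_measurable[OF g]
  let ?h = "inv g"
  have h: "orthogonal_transformation ?h" by (rule orthogonal_transformation_inv[OF g])
  have gh: "g (?h z) = z" for z by (rule surj_f_inv_f[OF orthogonal_transformation_surj[OF g]])
  have ip: "z \<bullet> g x = ?h z \<bullet> x" for z x
    using g gh[of z] by (metis orthogonal_transformation_def)
  have ft: "fourier_transform (distr \<mu> borel g) z = fourier_transform \<mu> (?h z)" for z
    unfolding fourier_transform_def by (subst integral_distr) (auto simp: ip)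
  have nh: "norm z = norm (?h z)" for z using orthogonal_transformation_norm[OF h] by simp
  have [measurable]: "fourier_transform \<mu> \<in> borel_measurable borel"
    by (rule fourier_transform_measurable[OF fin sets])
  have "(SUP z. ennreal (norm (fourier_transform \<mu> (?h z)) ^ 2 * norm (?h z) powr s))
      = (SUP z\<in>range ?h. ennreal (norm (fourier_transform \<mu> z) ^ 2 * norm z powr s))"
    by (simp add: image_comp comp_def)
  also have "range ?h = UNIV" by (rule orthogonal_transformation_surj[OF h])
  finally show ?thesis
    unfolding fourier_energy_def ft
    by (subst (1 2) nh)
       (simp add: nn_integral_lborel_orthogonal_transformation[OF h, where
         h = "\<lambda>z. ennreal (norm (fourier_transform \<mu> z) powr (2 / \<theta>) * norm z powr (s / \<theta> - real DIM('a)))"])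
qed

text \<open>Young's inequality needs \<open>\<theta> < 1\<close>; as \<open>\<mu>^\<close> is bounded, the endpoint \<open>\<theta> = 1\<close> reduces to that case.\<close>

lemma fourier_energy_lt_1:
  fixes \<mu> :: "'a::euclidean_space measure"
  assumes fin: "finite_measure \<mu>" and sets: "sets \<mu> = sets borel"
    and \<theta>: "0 < \<theta>" "\<theta> < 1" and energy: "fourier_energy s 1 \<mu> < \<infinity>"
  shows "fourier_energy (s * \<theta>) \<theta> \<mu> < \<infinity>"
proof -
  define F where "F z = norm (fourier_transform \<mu> z)" for z
  have [measurable]: "fourier_transform \<mu> \<in> borel_measurable borel"
    by (rule fourier_transform_measurable[OF fin sets])
  have [measurable]: "F \<in> borel_measurable borel" unfolding F_def by measurable
  have F0: "F z \<ge> 0" for z by (simp add: F_def)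
  define M where "M = measure \<mu> (space \<mu>)"
  have FM: "F z \<le> M" for z unfolding F_def M_def by (rule norm_fourier_transform_le[OF fin])
  have "1 / \<theta> \<ge> 1" using \<theta> by simp
  then have e: "2 / \<theta> - 2 \<ge> 0" by (simp add: field_simps)
  have fin1: "(\<integral>\<^sup>+z. ennreal (F z powr 2 * norm z powr (s - real DIM('a))) \<partial>lborel) < \<infinity>"
    using energy by (auto simp: fourier_energy_def ennreal_powr_def F_def less_top split: if_splits)
  \<comment> \<open>Scaling \<open>s\<close> by \<theta> leaves the exponent of
    \<open>norm z\<close> equal to \<open>s - d\<close>, with \<open>d\<close> the dimension; the
    surplus power \<open>2 / \<theta> - 2\<close> of the bounded transform is estimated by the total
    mass.\<close>
  have pt: "F z powr (2 / \<theta>) * norm z powr (s * \<theta> / \<theta> - real DIM('a))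
      \<le> M powr (2 / \<theta> - 2) * (F z powr 2 * norm z powr (s - real DIM('a)))" for z
  proof -
    have "F z powr (2 / \<theta>) = F z powr (2 / \<theta> - 2) * F z powr 2" by (simp flip: powr_add)
    also have "\<dots> \<le> M powr (2 / \<theta> - 2) * F z powr 2"
      using F0 FM e by (intro mult_right_mono powr_mono2) auto
    finally show ?thesis using \<theta> by (simp add: mult_right_mono mult.assoc[symmetric])
  qed
  have "(\<integral>\<^sup>+z. ennreal (F z powr (2 / \<theta>) * norm z powr (s * \<theta> / \<theta> - real DIM('a))) \<partial>lborel)
    \<le> (\<integral>\<^sup>+z. ennreal (M powr (2 / \<theta> - 2)) * ennreal (F z powr 2 * norm z powr (s - real DIM('a))) \<partial>lborel)"
    using pt by (intro nn_integral_mono) (auto simp: ennreal_mult'[symmetric] intro!: ennreal_leI)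
  also have "\<dots> < \<infinity>"
    using fin1 by (subst nn_integral_cmult) (auto simp: ennreal_mult_less_top)
  finally show ?thesis using \<theta> by (simp add: fourier_energy_def ennreal_powr_def F_def)
qed

text \<open>This reduces a general subspace to a coordinate subspace, where Gaussians factor. The
  standard basis is sent to an orthonormal basis adapted to \<open>V\<close> and its orthogonal
  complement, with \<open>S\<close> going to the part in \<open>V\<close>.\<close>

lemma grassmannian_rotation:
  fixes V :: "'a::euclidean_space set"
  assumes V: "V \<in> grassmannian k"
  obtains h :: "'a \<Rightarrow> 'a" and S where "orthogonal_transformation h" "S \<subseteq> Basis" "card S = k"
    "\<And>x. orth_proj V (h x) = h (coord_proj S x)"
proof -
  have sV: "subspace V" and dV: "dim V = k" using V by (auto simp: grassmannian_def)
  define W where "W = {y \<in> UNIV. \<forall>x\<in>V. orthogonal x y}"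
  have dW: "dim W + k = DIM('a)"
    unfolding W_def dV[symmetric] using dim_subspace_orthogonal_to_vectors[OF sV subspace_UNIV] by simp
  have sW: "subspace W" unfolding W_def using subspace_orthogonal_to_vectors[of V] by simp
  obtain B1 where B1: "B1 \<subseteq> V" "pairwise orthogonal B1" "\<And>x. x \<in> B1 \<Longrightarrow> norm x = 1"
    "independent B1" "card B1 = dim V" "span B1 = V"
    using orthonormal_basis_subspace[OF sV] by blast
  obtain B2 where B2: "B2 \<subseteq> W" "pairwise orthogonal B2" "\<And>x. x \<in> B2 \<Longrightarrow> norm x = 1"
    "independent B2" "card B2 = dim W" "span B2 = W"
    using orthonormal_basis_subspace[OF sW] by blast
  obtain S :: "'a set" where S: "S \<subseteq> Basis" "card S = k" "finite S"
    using obtain_subset_with_card_n[of k "Basis :: 'a set"] dW by auto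
  have "finite B1" "finite B2" using B1 B2 independent_imp_finite by auto
  moreover have "card (Basis - S) = card B2" using S dW B2 by (simp add: card_Diff_subset)
  ultimately obtain p1 p2 where p1: "bij_betw p1 S B1" and p2: "bij_betw p2 (Basis - S) B2"
    using finite_same_card_bij[of S B1] finite_same_card_bij[of "Basis - S" B2] S B1 dV by auto
  define p where "p b = (if b \<in> S then p1 b else p2 b)" for b
  have pS: "p ` S = B1" using p1 by (simp add: p_def bij_betw_def)
  have on: "p b \<bullet> p c = (if b = c then 1 else 0)" if "b \<in> Basis" "c \<in> Basis" for b c
  proof -
    have in1: "p1 b \<in> B1" if "b \<in> S" for b using p1 that by (auto simp: bij_betw_def)
    have in2: "p2 b \<in> B2" if "b \<in> Basis - S" for b using p2 that by (auto simp: bij_betw_def)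
    have 12: "x \<bullet> y = 0" "y \<bullet> x = 0" if "x \<in> B1" "y \<in> B2" for x y
      using that B1(1) B2(1) by (auto simp: W_def orthogonal_def inner_commute subset_iff)
    have 11: "p1 b \<bullet> p1 c = (if b = c then 1 else 0)" if "b \<in> S" "c \<in> S" for b c
    proof (cases "b = c")
      case True
      then show ?thesis using in1[OF that(1)] B1(3) by (simp add: norm_eq_1[symmetric])
    next
      case False
      then have "p1 b \<noteq> p1 c" using p1 that by (auto simp: bij_betw_def inj_on_def)
      then show ?thesis using False that in1 B1(2) by (auto simp: pairwise_def orthogonal_def)
    qed
    have 22: "p2 b \<bullet> p2 c = (if b = c then 1 else 0)" if "b \<in> Basis - S" "c \<in> Basis - S" for b c
    proof (cases "b = c")
      case True
      then show ?thesis using in2[OF that(1)] B2(3) by (simp add: norm_eq_1[symmetric])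
    next
      case False
      then have "p2 b \<noteq> p2 c" using p2 that by (auto simp: bij_betw_def inj_on_def)
      then show ?thesis using False that in2 B2(2) by (auto simp: pairwise_def orthogonal_def)
    qed
    show ?thesis using that in1 in2 12 11[of b c] 22[of b c] by (auto simp: p_def)
  qed
  \<comment> \<open>The linear extension of \<open>p\<close>; it preserves inner products because
    the images of the basis vectors are orthonormal.\<close>
  define h where "h x = (\<Sum>b\<in>Basis. (x \<bullet> b) *\<^sub>R p b)" for x :: 'a
  have lin: "linear h"
    by (rule linearI) (simp_all add: h_def inner_add_left scaleR_add_left sum.distrib scaleR_sum_right)
  have hp: "h x \<bullet> p c = x \<bullet> c" if "c \<in> Basis" for x c
    using that by (simp add: h_def inner_sum_left on if_distrib cong: if_cong)
  have hb: "h b = p b" if "b \<in> Basis" for b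
    using that by (simp add: h_def inner_Basis if_distrib[of "\<lambda>c. c *\<^sub>R _"] cong: if_cong)
  have orth: "orthogonal_transformation h"
    unfolding orthogonal_transformation_def
  proof (intro conjI lin allI)
    fix v w
    have "h v \<bullet> h w = (\<Sum>b\<in>Basis. (w \<bullet> b) * (h v \<bullet> p b))"
      by (subst (2) h_def) (simp add: inner_sum_right)
    also have "\<dots> = v \<bullet> w" by (subst (3) euclidean_inner) (simp add: hp mult.commute)
    finally show "h v \<bullet> h w = v \<bullet> w" .
  qed
  have hc: "h (coord_proj S x) = (\<Sum>b\<in>S. (x \<bullet> b) *\<^sub>R p b)" for x
    unfolding coord_proj_def using S hb by (auto simp: linear_sum[OF lin] linear_scale[OF lin] intro!: sum.cong)
  have "orth_proj V (h x) = h (coord_proj S x)" for x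
    unfolding orth_proj_def
  proof (rule the_equality, intro conjI ballI)
    show inV: "h (coord_proj S x) \<in> V"
      unfolding hc using pS B1(1) by (intro subspace_sum[OF sV] subspace_scale[OF sV]) auto
    show ort: "orthogonal (h x - h (coord_proj S x)) v" if "v \<in> V" for v
    proof (rule orthogonal_to_span[of v B1])
      show "v \<in> span B1" using that B1 by simp
      fix y assume "y \<in> B1"
      then obtain c where c: "c \<in> S" "y = p c" using pS by auto
      then have cB: "c \<in> Basis" using S by auto
      have "(\<Sum>b\<in>S. (x \<bullet> b) *\<^sub>R p b) \<bullet> p c = (\<Sum>b\<in>S. (x \<bullet> b) * (if b = c then 1 else 0))"
        unfolding inner_sum_left using S cB by (intro sum.cong) (auto simp: on)
      also have "\<dots> = x \<bullet> c" using c S by (simp add: if_distrib cong: if_cong)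
      finally show "orthogonal (h x - h (coord_proj S x)) y"
        using hp[OF cB] by (simp add: orthogonal_def c inner_diff_left hc)
    qed
    fix y assume y: "y \<in> V \<and> (\<forall>v\<in>V. orthogonal (h x - y) v)"
    let ?z = "h (coord_proj S x)"
    \<comment> \<open>Uniqueness of the projection: the difference of two candidates lies in
      \<open>V\<close> and is orthogonal to every vector of \<open>V\<close>, hence to
      itself.\<close>
    have zV: "y - ?z \<in> V" using y inV subspace_diff[OF sV] by blast
    then have "(h x - y) \<bullet> (y - ?z) = 0" "(h x - ?z) \<bullet> (y - ?z) = 0"
      using y ort by (auto simp: orthogonal_def)
    then have "(y - ?z) \<bullet> (y - ?z) = 0" by (simp add: inner_diff_left)
    then show "y = ?z" by simp
  qed
  then show thesis using that[OF orth S(1,2)] by blast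
qed

text \<open>The measure is rotated so that \<open>V\<close> becomes a coordinate subspace. The
  rotated measure then satisfies the correlation bound, and the mass distribution argument is
  applied along the projection.\<close>

lemma hausdorff_measure_orth_proj_pos:
  fixes \<mu> :: "'a::euclidean_space measure" and X :: "'a set"
  assumes \<mu>: "\<mu> \<in> supported_measures X" and X[measurable]: "X \<in> sets borel"
    and V: "V \<in> grassmannian k"
    and \<theta>: "0 \<le> \<theta>" "\<theta> < 1" and t: "0 \<le> t" "t < real k" "t + (real DIM('a) - real k) * \<theta> < s"
    and energy: "fourier_energy s \<theta> \<mu> < \<infinity>"
  shows "hausdorff_measure t (orth_proj V ` X) > 0"
proof -
  note \<mu>D = supported_measuresD[OF \<mu> X]
  note [measurable_cong] = \<mu>D(2)
  have sp: "space \<mu> = UNIV" using sets_eq_imp_space_eq[OF \<mu>D(2)] by simp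
  obtain h :: "'a \<Rightarrow> 'a" and S where h: "orthogonal_transformation h" and S: "S \<subseteq> Basis" "card S = k"
    and proj: "\<And>x. orth_proj V (h x) = h (coord_proj S x)"
    using grassmannian_rotation[OF V] by blast
  define g where "g = inv h"
  have g: "orthogonal_transformation g" unfolding g_def by (rule orthogonal_transformation_inv[OF h])
  have hg: "h (g x) = x" for x unfolding g_def by (rule surj_f_inv_f[OF orthogonal_transformation_surj[OF h]])
  note [measurable] = orthogonal_transformation_measurable[OF g] orthogonal_transformation_measurable[OF h]
  define \<nu> where "\<nu> = distr \<mu> borel g"
  have sets\<nu>: "sets \<nu> = sets borel" and sp\<nu>: "space \<nu> = UNIV" by (auto simp: \<nu>_def)
  note [measurable_cong] = sets\<nu>
  have fin\<nu>: "finite_measure \<nu>" unfolding \<nu>_def by (rule finite_measure.finite_measure_distr[OF \<mu>D(1)]) measurable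
  obtain R where R: "AE x in \<mu>. norm x \<le> R" using \<mu>D(4) by blast
  have R\<nu>: "AE x in \<nu>. norm x \<le> R"
    unfolding \<nu>_def using R by (subst AE_distr_iff) (auto simp: orthogonal_transformation_norm[OF g])
  have X\<nu>: "AE x in \<nu>. h x \<in> X"
    unfolding \<nu>_def using \<mu>D(3) by (subst AE_distr_iff) (auto simp: hg)
  have pos\<nu>: "emeasure \<nu> (space \<nu>) > 0"
    unfolding \<nu>_def using \<mu>D(5) sp by (simp add: emeasure_distr)
  \<comment> \<open>The strict inequalities leave room above \<open>t\<close>, and the gap between
    \<open>t\<close> and \<open>t'\<close> makes the dyadic series converge.\<close>
  obtain t' where t': "t < t'" "t' < real k" "t' + (real DIM('a) - real k) * \<theta> \<le> s"
  proof -
    have "t < min (real k) (s - (real DIM('a) - real k) * \<theta>)" using t by auto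
    then obtain t' where "t < t'" "t' < min (real k) (s - (real DIM('a) - real k) * \<theta>)"
      using dense by blast
    then show thesis by (intro that[of t']) auto
  qed
  have energy\<nu>: "fourier_energy s \<theta> \<nu> < \<infinity>"
    unfolding \<nu>_def using energy fourier_energy_distr_orthogonal[OF g \<mu>D(1,2)] by simp
  obtain C where C: "\<And>r. 0 < r \<Longrightarrow> r \<le> 1 \<Longrightarrow>
    (\<integral>\<^sup>+x. emeasure \<nu> {y\<in>space \<nu>. dist (coord_proj S x) (coord_proj S y) \<le> r} \<partial>\<nu>) \<le> ennreal (C * r powr t')"
    using correlation_bound[OF fin\<nu> sets\<nu> R\<nu> S(1) \<theta>, of t' s] t' energy\<nu> S(2) by blast
  \<comment> \<open>Rotating back by \<open>h\<close> preserves distances, so the correlation bound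
    for \<open>coord_proj S\<close> holds for the projection to \<open>V\<close> as well.\<close>
  have dh: "dist (h a) (h b) = dist a b" for a b
    using orthogonal_transformation_norm[OF h, of "a - b"] linear_diff[OF orthogonal_transformation_linear[OF h]]
    by (simp add: dist_norm)
  have "hausdorff_measure t ((\<lambda>x. h (coord_proj S x)) ` (h -` X)) > 0"
  proof (rule hausdorff_measure_pos_of_correlation[OF fin\<nu> _ pos\<nu> _ t(1) t'(1)])
    show "(\<lambda>x. h (coord_proj S x)) \<in> borel_measurable \<nu>" by measurable
    show "AE x in \<nu>. x \<in> h -` X" using X\<nu> by simp
  qed (use C in \<open>simp add: dh\<close>)
  also have "(\<lambda>x. h (coord_proj S x)) ` (h -` X) = orth_proj V ` X"
  proof -
    have "(\<lambda>x. h (coord_proj S x)) ` (h -` X) = orth_proj V ` (h ` (h -` X))"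
      by (simp only: image_image proj)
    then show ?thesis unfolding surj_image_vimage_eq[OF orthogonal_transformation_surj[OF h]] .
  qed
  finally show ?thesis .
qed

text \<open>For nonnegative \<open>c\<close> the default value 0 of an empty supremum cannot exceed
  \<open>c\<close>, so an actual element can be extracted.\<close>

lemma less_Sup0_iff:
  assumes "0 \<le> c"
  shows "c < Sup0 A \<longleftrightarrow> (\<exists>x\<in>A. c < x)"
  using assms by (auto simp: Sup0_def less_Sup_iff)

section \<open>Reduction of the theorem to one measure and one pair of exponents\<close>

theorem proposition4p3:
  fixes X :: "(real ^ 'd) set" and k :: nat and u :: real
  assumes "1 \<le> k" and "k < CARD('d)"
    and "X \<in> sets borel"
    and "0 \<le> u" and "u \<le> real k"
    and "ereal u \<le> (SUP \<theta>\<in>{0..1}. fourier_dim \<theta> X - ereal ((real CARD('d) - real k) * \<theta>))"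
  shows "{V \<in> grassmannian k. hausdorff_dim (orth_proj V ` X) < ereal u} = {}"
proof (rule ccontr)
  let ?d = "real CARD('d) - real k"
  assume "{V \<in> grassmannian k. hausdorff_dim (orth_proj V ` X) < ereal u} \<noteq> {}"
  then obtain V where V: "V \<in> grassmannian k" and "hausdorff_dim (orth_proj V ` X) < ereal u" by blast
  \<comment> \<open>A dimension below \<open>u\<close> yields an exponent \<open>t < u\<close> with
    vanishing Hausdorff measure; the contradiction arises at this \<open>t\<close>.\<close>
  then obtain t where t: "0 \<le> t" "t < u" and zero: "hausdorff_measure t (orth_proj V ` X) = 0"
    unfolding hausdorff_dim_def Inf_less_iff by auto
  have tk: "t < real k" using t assms by simp
  have "ereal t < (SUP \<theta>\<in>{0..1}. fourier_dim \<theta> X - ereal (?d * \<theta>))"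
    using less_le_trans[OF _ assms(6), of "ereal t"] t(2) by simp
  then obtain \<theta> where \<theta>: "0 \<le> \<theta>" "\<theta> \<le> 1" and "ereal t < fourier_dim \<theta> X - ereal (?d * \<theta>)"
    by (auto simp: less_SUP_iff)
  then have dim: "ereal (t + ?d * \<theta>) < fourier_dim \<theta> X"
    by (cases "fourier_dim \<theta> X") auto
  have nonneg: "0 \<le> ereal (t + ?d * \<theta>)" using t \<theta> assms(2) by simp
  obtain \<mu> where \<mu>: "\<mu> \<in> supported_measures X" and dim\<mu>: "ereal (t + ?d * \<theta>) < fourier_dim_measure \<theta> \<mu>"
    using dim unfolding fourier_dim_def less_Sup0_iff[OF nonneg] by auto
  obtain s where s: "fourier_energy s \<theta> \<mu> < \<infinity>" "t + ?d * \<theta> < s"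
    using dim\<mu> unfolding fourier_dim_measure_def less_Sup0_iff[OF nonneg] by auto
  have "\<exists>\<theta> s. 0 \<le> \<theta> \<and> \<theta> < 1 \<and> fourier_energy s \<theta> \<mu> < \<infinity> \<and> t + ?d * \<theta> < s"
  proof (cases "\<theta> = 1")
    case True
    \<comment> \<open>Passing from 1 to \<open>\<eta> < 1\<close> replaces \<open>s\<close> by
      \<open>s * \<eta>\<close>, so the required inequality becomes \<open>t < \<eta> * e\<close>.
      Since \<open>t < e\<close>, it holds for \<eta> close enough to 1.\<close>
    define e where "e = s - ?d"
    have e: "t < e" "0 < e" using s(2) True t by (auto simp: e_def)
    then have "t / e < 1" by simp
    then obtain \<eta> where \<eta>: "t / e < \<eta>" "\<eta> < 1" using dense by blast
    have "0 \<le> t / e" using t e by simp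
    then have \<eta>0: "0 < \<eta>" using \<eta> by linarith
    have "t < \<eta> * e" using \<eta>(1) e by (simp add: divide_less_eq)
    then have "t + ?d * \<eta> < s * \<eta>" by (simp add: e_def algebra_simps)
    moreover have "fourier_energy (s * \<eta>) \<eta> \<mu> < \<infinity>"
      using fourier_energy_lt_1[OF supported_measuresD(1,2)[OF \<mu> assms(3)] \<eta>0 \<eta>(2)] s(1) True by simp
    ultimately show ?thesis using \<eta>0 \<eta>(2) by (intro exI[of _ \<eta>] exI[of _ "s * \<eta>"]) auto
  next
    case False
    then show ?thesis using \<theta> s by (intro exI[of _ \<theta>] exI[of _ s]) auto
  qed
  then obtain \<theta>' s' where "0 \<le> \<theta>'" "\<theta>' < 1" "fourier_energy s' \<theta>' \<mu> < \<infinity>" "t + ?d * \<theta>' < s'"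
    by blast
  then have "hausdorff_measure t (orth_proj V ` X) > 0"
    using hausdorff_measure_orth_proj_pos[OF \<mu> assms(3) V _ _ t(1) tk] by simp
  with zero show False by simp
qed

end
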